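(* Let $X$ be a separable, infinite-dimensional reflexive Banach space and let $T:X\to X$ be a frequently hypercyclic bounded linear operator. Then $T$ admits a $T$-invariant Borel probability measure $m$ on $X$ which has full support and is continuous. Moreover, $m$ may be chosen so that $m(\mathrm{Per}(T))=0$.
   Context: For $x\in X$ and $B\subset X$, $\mathcal N_T(x,B)=\{n\in\mathbb N: T^nx\in B\}$. $T$ is frequently hypercyclic if there is $x\in X$ such that for every nonempty open $V\subset X$, $\liminf_{N\to\infty}\frac1N\#\{n\in[1,N]: T^nx\in V\}>0$. A Borel probability measure $m$ is $T$-invariant if $m(T^{-1}(A))=m(A)$ for all Borel $A$; it has full support if $m(U)>0$ for every nonempty open $U$; it is continuous if $m(\{a\})=0$ for every $a\in X$. $\mathrm{Per}(T)$ denotes the set of periodic points of $T$, i.e. $x$ with $T^Nx=x$ for some $N\ge1$. *)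

theory Defs
  imports "HOL-Analysis.Analysis" "HOL-Probability.Probability"
begin

definition bidual_embedding :: "'a::real_normed_vector \<Rightarrow> (('a \<Rightarrow>\<^sub>L real) \<Rightarrow>\<^sub>L real)" where
  "bidual_embedding x = Blinfun (\<lambda>f. blinfun_apply f x)"

definition reflexive_space :: "'a::real_normed_vector itself \<Rightarrow> bool" where
  "reflexive_space _ \<longleftrightarrow> surj (bidual_embedding :: 'a \<Rightarrow> _)"

definition separable_space :: "'a::topological_space itself \<Rightarrow> bool" where
  "separable_space _ \<longleftrightarrow> (\<exists>D::'a set. countable D \<and> closure D = UNIV)"

definition infinite_dimensional :: "'a::real_vector itself \<Rightarrow> bool" where
  "infinite_dimensional _ \<longleftrightarrow> \<not> (\<exists>B::'a set. finite B \<and> span B = UNIV)"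

definition frequently_hypercyclic :: "('a::topological_space \<Rightarrow> 'a) \<Rightarrow> bool" where
  "frequently_hypercyclic T \<longleftrightarrow>
     (\<exists>x. \<forall>V. open V \<and> V \<noteq> {} \<longrightarrow>
        liminf (\<lambda>N::nat. ereal (real (card {n\<in>{1..N}. (T ^^ n) x \<in> V}) / real N)) > 0)"

definition Per :: "('a \<Rightarrow> 'a) \<Rightarrow> 'a set" where
  "Per T = {x. \<exists>N\<ge>1. (T ^^ N) x = x}"

end

theory Submission
  imports Defs
begin

text \<open>
  Let \<open>x\<^sub>0\<close> be a frequently hypercyclic vector. Record for every orbit point the sequence of bits telling
  which of countably many balls and half-spaces its iterates visit. Along a subsequence the empirical
  frequencies of all cylinders of the Cantor space converge, and the limits extend to a probability
  measure invariant under the shift. By reflexivity, almost every code whose first point is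
  recorded in some ball is the code of a weak limit \<open>x\<close>, and the shifted code then belongs to \<open>T x\<close>. Pushing
  the measure forward to \<open>X\<close> gives an invariant probability \<open>m\<close>, and positive lower densities of visits to balls
  give it full support.

  Next one finds an invariant \<open>n\<close> with \<open>n(Per T) = 0\<close>: if \<open>m(Per T) < 1\<close>, condition \<open>m\<close> on the complement;
  otherwise take the law of a random series of rescaled periodic points. Finally \<open>x + t z\<close>,
  with \<open>x, z, t\<close> independent of laws \<open>m\<close>, \<open>n\<close> and uniform on the unit interval, has the required law.
\<close>

section \<open>Hahn--Banach extension\<close>

text \<open>Closed balls of an infinite-dimensional \<open>X\<close> are not norm compact, so
  empirical measures of the orbit have no evident limit on \<open>X\<close> itself. On the compact
  space of codes limits come for free, but mass can escape to codes that record no ball; positive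
  lower density of visits to balls leaves positive mass on the other codes, on which one then
  conditions. Balls and half-spaces are the tests because both are weakly closed: balls bound and
  locate the limit, half-spaces determine it.

  Full support alone does not keep \<open>m\<close> off \<open>Per T\<close>, a countable union of
  closed proper subspaces that may be dense. Conditioning on its complement may destroy full
  support, so the two properties come from separate measures merged by \<open>x + t z\<close>. The
  random factor \<open>t\<close> is the device behind both the random series and the final sum: a
  line not parallel to a subspace meets it at most once, and a single value of \<open>t\<close> has
  probability zero.\<close>

definition sublinear :: "('a::real_vector \<Rightarrow> real) \<Rightarrow> bool" where
  "sublinear p \<longleftrightarrow> (\<forall>x y. p (x + y) \<le> p x + p y) \<and> (\<forall>c x. c > 0 \<longrightarrow> p (c *\<^sub>R x) \<le> c * p x)"

lemma sublinear_add: "sublinear p \<Longrightarrow> p (x + y) \<le> p x + p y"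
  and sublinear_scale_le: "sublinear p \<Longrightarrow> c > 0 \<Longrightarrow> p (c *\<^sub>R x) \<le> c * p x"
  by (auto simp: sublinear_def)

lemma sublinear_zero:
  assumes "sublinear p" shows "p 0 = 0"
  using sublinear_scale_le[OF assms, of 2 0] sublinear_scale_le[OF assms, of "1/2" 0] by simp

text \<open>The definition asks only for an inequality with positive scalars, which is easy to
  verify for infima; applying it to \<open>c\<close> and to \<open>1/c\<close> gives
  equality.\<close>

lemma sublinear_scale:
  assumes "sublinear p" "c \<ge> 0" shows "p (c *\<^sub>R x) = c * p x"
proof (cases "c = 0")
  case True then show ?thesis by (simp add: sublinear_zero[OF assms(1)])
next
  case False
  then have c: "c > 0" using assms by simp
  have "p ((1/c) *\<^sub>R (c *\<^sub>R x)) \<le> (1/c) * p (c *\<^sub>R x)"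
    by (rule sublinear_scale_le) (use assms c in auto)
  then have "c * p x \<le> p (c *\<^sub>R x)" using c by (simp add: field_simps)
  then show ?thesis using sublinear_scale_le[OF assms(1) c, of x] by simp
qed

lemma sublinear_minus:
  assumes "sublinear p" shows "- p (- x) \<le> p x"
  using sublinear_add[OF assms, of x "-x"] sublinear_zero[OF assms] by simp

text \<open>Lowering a sublinear functional in the direction \<open>y\<close> keeps it sublinear; functionals that cannot be
  lowered further are linear.\<close>

definition lower_along :: "('a::real_vector \<Rightarrow> real) \<Rightarrow> 'a \<Rightarrow> 'a \<Rightarrow> real" where
  "lower_along p y x = (INF t\<in>{0..}. p (x + t *\<^sub>R y) - t * p y)"

text \<open>The infimum is finite: subadditivity applied to
  \<open>t *\<^sub>R y = (x + t *\<^sub>R y) + (- x)\<close> bounds every term below by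
  \<open>- p (- x)\<close>.\<close>

lemma lower_along_le:
  assumes "sublinear p" "t \<ge> 0" shows "lower_along p y x \<le> p (x + t *\<^sub>R y) - t * p y"
  unfolding lower_along_def
proof (rule cINF_lower)
  show "bdd_below ((\<lambda>t. p (x + t *\<^sub>R y) - t * p y) ` {0..})"
  proof (rule bdd_belowI2)
    fix t :: real assume "t \<in> {0..}"
    then have "t * p y = p ((x + t *\<^sub>R y) + - x)" using sublinear_scale[OF assms(1)] by simp
    also have "\<dots> \<le> p (x + t *\<^sub>R y) + p (- x)" by (rule sublinear_add[OF assms(1)])
    finally show "- p (- x) \<le> p (x + t *\<^sub>R y) - t * p y" by simp
  qed
qed (use assms in auto)

lemma sublinear_lower_along:
  assumes p: "sublinear p" shows "sublinear (lower_along p y)"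
  unfolding sublinear_def
proof (intro conjI allI impI)
  fix x z
  have *: "lower_along p y (x + z) \<le> (p (x + t *\<^sub>R y) - t * p y) + (p (z + s *\<^sub>R y) - s * p y)"
    if "t \<ge> 0" "s \<ge> 0" for t s
  proof -
    have "lower_along p y (x + z) \<le> p ((x + z) + (t + s) *\<^sub>R y) - (t + s) * p y"
      by (rule lower_along_le[OF p]) (use that in auto)
    also have "p ((x + z) + (t + s) *\<^sub>R y) \<le> p (x + t *\<^sub>R y) + p (z + s *\<^sub>R y)"
      using sublinear_add[OF p, of "x + t *\<^sub>R y" "z + s *\<^sub>R y"] by (simp add: algebra_simps)
    finally show ?thesis by (simp add: algebra_simps)
  qed
  have "lower_along p y (x + z) - (p (x + t *\<^sub>R y) - t * p y) \<le> lower_along p y z" if "t \<ge> 0" for t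
    unfolding lower_along_def[of p y z] by (rule cINF_greatest) (use *[OF that] in force)+
  then have "lower_along p y (x + z) - lower_along p y z \<le> lower_along p y x"
    unfolding lower_along_def[of p y x] by (intro cINF_greatest) force+
  then show "lower_along p y (x + z) \<le> lower_along p y x + lower_along p y z" by simp
next
  fix c :: real and x assume c: "c > 0"
  have "lower_along p y (c *\<^sub>R x) / c \<le> lower_along p y x"
    unfolding lower_along_def[of p y x]
  proof (rule cINF_greatest)
    fix t :: real assume t: "t \<in> {0..}"
    have "lower_along p y (c *\<^sub>R x) \<le> p (c *\<^sub>R x + (c * t) *\<^sub>R y) - (c * t) * p y"
      by (rule lower_along_le[OF p]) (use t c in auto)
    also have "\<dots> = c * (p (x + t *\<^sub>R y) - t * p y)"
      using sublinear_scale[OF p, of c "x + t *\<^sub>R y"] c by (simp add: algebra_simps)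
    finally show "lower_along p y (c *\<^sub>R x) / c \<le> p (x + t *\<^sub>R y) - t * p y"
      using c by (simp add: field_simps)
  qed auto
  then show "lower_along p y (c *\<^sub>R x) \<le> c * lower_along p y x" using c by (simp add: field_simps)
qed

text \<open>Minimality makes each \<open>lower_along q y\<close> equal to \<open>q\<close>; its term
  for \<open>t = 1\<close> then yields \<open>q x \<le> q (x + y) - q y\<close>, the reverse of
  subadditivity.\<close>

lemma minimal_sublinear_imp_linear:
  assumes q: "sublinear q" and min: "\<And>r. sublinear r \<Longrightarrow> r \<le> q \<Longrightarrow> r = q"
  shows "linear q"
proof -
  have eq: "lower_along q y = q" for y
    by (rule min[OF sublinear_lower_along[OF q]])
      (use lower_along_le[OF q, of 0 y] in \<open>auto simp: le_fun_def\<close>)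
  have add: "q (x + y) = q x + q y" for x y
    using lower_along_le[OF q, of 1 y x] sublinear_add[OF q, of x y] by (simp add: eq)
  have neg: "q (- x) = - q x" for x
    using add[of x "-x"] sublinear_zero[OF q] by simp
  show ?thesis
  proof (rule linearI)
    fix c x show "q (c *\<^sub>R x) = c *\<^sub>R q x"
      using sublinear_scale[OF q, of c x] sublinear_scale[OF q, of "-c" x] neg[of "c *\<^sub>R x"]
      by (cases "c \<ge> 0") auto
  qed (rule add)
qed

text \<open>Zorn's lemma is applied below \<open>lower_along p x0\<close> rather than below
  \<open>p\<close>: its value at \<open>- x0\<close> is at most \<open>- p x0\<close>, which forces
  \<open>f x0 = p x0\<close> for the minimal functional found. The order is reversed, so that a
  maximal element is a minimal functional.\<close>

theorem Hahn_Banach: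
  fixes p :: "'a::real_vector \<Rightarrow> real"
  assumes p: "sublinear p"
  obtains f where "linear f" "\<And>x. f x \<le> p x" "f x0 = p x0"
proof -
  let ?p = "lower_along p x0"
  let ?A = "{q. sublinear q \<and> q \<le> ?p}"
  let ?P = "\<lambda>q r :: 'a \<Rightarrow> real. r \<le> q"
  have "\<exists>m\<in>?A. \<forall>a\<in>?A. a \<le> m \<longrightarrow> a = m"
  proof (rule predicate_Zorn[where P = ?P])
    show "partial_order_on ?A (relation_of ?P ?A)"
      by (auto simp: partial_order_on_def preorder_on_def refl_on_def trans_def antisym_def relation_of_def)
  next
    fix C assume "C \<in> Chains (relation_of ?P ?A)"
    then have CA: "C \<subseteq> ?A" and ch: "\<And>q r. q \<in> C \<Longrightarrow> r \<in> C \<Longrightarrow> q \<le> r \<or> r \<le> q"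
      by (auto simp: Chains_def relation_of_def)
    show "\<exists>u\<in>?A. \<forall>a\<in>C. u \<le> a"
    proof (cases "C = {}")
      case True
      then show ?thesis using sublinear_lower_along[OF p] by auto
    next
      case False
      define u where "u x = (INF q\<in>C. q x)" for x
      have sub: "q \<in> C \<Longrightarrow> sublinear q" for q using CA by auto
      have ule: "u x \<le> q x" if "q \<in> C" for q x
        unfolding u_def
      proof (rule cINF_lower[OF _ that])
        show "bdd_below ((\<lambda>q. q x) ` C)"
        proof (rule bdd_belowI2)
          fix q assume "q \<in> C"
          then have "sublinear q" "q (-x) \<le> ?p (-x)" using CA by (auto simp: le_fun_def)
          then show "- ?p (- x) \<le> q x" using sublinear_minus[of q x] by linarith
        qed
      qed
      have gr: "b \<le> u x" if "\<And>q. q \<in> C \<Longrightarrow> b \<le> q x" for b x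
        unfolding u_def using False that by (intro cINF_greatest)
      have "sublinear u"
        unfolding sublinear_def
      proof (intro conjI allI impI)
        fix x y
        \<comment> \<open>An infimum of sublinear functionals need not be subadditive; in a chain
          the smaller of \<open>q\<close> and \<open>r\<close> can replace both.\<close>
        have *: "u (x + y) \<le> q x + r y" if q: "q \<in> C" and r: "r \<in> C" for q r
        proof -
          obtain s where s: "s \<in> C" "s \<le> q" "s \<le> r" using ch[OF q r] q r by auto
          have "u (x + y) \<le> s (x + y)" by (rule ule[OF s(1)])
          also have "\<dots> \<le> s x + s y" by (rule sublinear_add[OF sub[OF s(1)]])
          also have "\<dots> \<le> q x + r y" using s by (auto simp: le_fun_def intro: add_mono)
          finally show ?thesis .
        qed
        have "u (x + y) - r y \<le> u x" if "r \<in> C" for r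
          using *[OF _ that] by (intro gr) (simp add: algebra_simps)
        then have "u (x + y) - u x \<le> u y" by (intro gr) (simp add: algebra_simps)
        then show "u (x + y) \<le> u x + u y" by simp
      next
        fix c :: real and x assume c: "c > 0"
        have "u (c *\<^sub>R x) / c \<le> u x"
        proof (rule gr)
          fix q assume q: "q \<in> C"
          have "u (c *\<^sub>R x) \<le> c * q x"
            using ule[OF q, of "c *\<^sub>R x"] sublinear_scale_le[OF sub[OF q] c, of x] by linarith
          then show "u (c *\<^sub>R x) / c \<le> q x" using c by (simp add: field_simps)
        qed
        then show "u (c *\<^sub>R x) \<le> c * u x" using c by (simp add: field_simps)
      qed
      moreover have "u \<le> ?p"
      proof -
        obtain q where q: "q \<in> C" using False by auto
        then have "u \<le> q" "q \<le> ?p" using ule CA by (auto simp: le_fun_def)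
        then show ?thesis by (rule order_trans)
      qed
      ultimately show ?thesis using ule by (intro bexI[of _ u]) (auto simp: le_fun_def)
    qed
  qed
  then obtain f where f: "sublinear f" "f \<le> ?p" and min: "\<And>a. sublinear a \<Longrightarrow> a \<le> ?p \<Longrightarrow> a \<le> f \<Longrightarrow> a = f"
    by auto
  have lin: "linear f"
    by (rule minimal_sublinear_imp_linear[OF f(1)]) (use min f(2) in \<open>auto intro: order_trans\<close>)
  have le: "f x \<le> p x" for x
    using le_funD[OF f(2), of x] lower_along_le[OF p, of 0 x0 x] by simp
  have "f (- x0) \<le> - p x0"
    using le_funD[OF f(2), of "- x0"] lower_along_le[OF p, of 1 x0 "- x0"] sublinear_zero[OF p] by simp
  then have "p x0 \<le> f x0" using linear_neg[OF lin, of x0] by simp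
  then show ?thesis using that[OF lin le] le[of x0] by simp
qed

lemma Hahn_Banach_norm:
  fixes x0 :: "'a::real_normed_vector"
  obtains f :: "'a \<Rightarrow>\<^sub>L real" where "norm f \<le> 1" "f x0 = norm x0"
proof -
  have "sublinear (norm :: 'a \<Rightarrow> real)" by (auto simp: sublinear_def norm_triangle_ineq)
  then obtain g where g: "linear g" "\<And>x. g x \<le> norm x" "g x0 = norm (x0::'a)"
    using Hahn_Banach by metis
  have bd: "norm (g x) \<le> norm x * 1" for x
    using g(2)[of x] g(2)[of "-x"] linear_neg[OF g(1), of x] by (simp add: abs_le_iff)
  have bl: "bounded_linear g"
    by (rule bounded_linear_intro[OF _ _ bd]) (use g(1) in \<open>auto simp: linear_add linear_cmul\<close>)
  show ?thesis
  proof (rule that[of "Blinfun g"])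
    show "norm (Blinfun g) \<le> 1"
      by (rule norm_blinfun_bound) (use bd in \<open>simp_all add: bounded_linear_Blinfun_apply[OF bl]\<close>)
  qed (simp add: bounded_linear_Blinfun_apply[OF bl] g)
qed

text \<open>The distance to \<open>V\<close> is sublinear and vanishes exactly on the closure of
  \<open>V\<close>, so a linear functional below it kills \<open>V\<close>, and one can be chosen to
  attain the distance at \<open>x0\<close>.\<close>

lemma Hahn_Banach_annihilator:
  fixes V :: "'a::real_normed_vector set"
  assumes V: "subspace V" and x0: "x0 \<notin> closure V"
  obtains f :: "'a \<Rightarrow>\<^sub>L real" where "\<And>x. x \<in> V \<Longrightarrow> f x = 0" "f x0 \<noteq> 0"
proof -
  have ne: "V \<noteq> {}" using subspace_0[OF V] by auto
  let ?p = "\<lambda>x. infdist x V"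
  have "sublinear ?p"
    unfolding sublinear_def
  proof (intro conjI allI impI)
    fix x y
    have *: "?p (x + y) \<le> dist x a + dist y b" if "a \<in> V" "b \<in> V" for a b
    proof -
      have "?p (x + y) \<le> dist (x + y) (a + b)" by (rule infdist_le) (use V that in \<open>auto intro: subspace_add\<close>)
      also have "\<dots> \<le> dist x a + dist y b" by (rule dist_triangle_add)
      finally show ?thesis .
    qed
    have "?p (x + y) - dist y b \<le> ?p x" if "b \<in> V" for b
      unfolding infdist_notempty[OF ne, of x] using ne *[OF _ that]
      by (intro cINF_greatest) (auto simp: algebra_simps)
    then have "?p (x + y) - ?p x \<le> ?p y"
      unfolding infdist_notempty[OF ne, of y] using ne by (intro cINF_greatest) (auto simp: algebra_simps)
    then show "?p (x + y) \<le> ?p x + ?p y" by simp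
  next
    fix c :: real and x assume c: "c > 0"
    have "?p (c *\<^sub>R x) / c \<le> ?p x"
      unfolding infdist_notempty[OF ne, of x]
    proof (rule cINF_greatest[OF ne])
      fix a assume a: "a \<in> V"
      have "?p (c *\<^sub>R x) \<le> dist (c *\<^sub>R x) (c *\<^sub>R a)" by (rule infdist_le) (use V a in \<open>auto intro: subspace_scale\<close>)
      also have "\<dots> = c * dist x a" using c by (simp add: dist_norm flip: scaleR_diff_right)
      finally show "?p (c *\<^sub>R x) / c \<le> dist x a" using c by (simp add: field_simps)
    qed
    then show "?p (c *\<^sub>R x) \<le> c * ?p x" using c by (simp add: field_simps)
  qed
  then obtain g where g: "linear g" "\<And>x. g x \<le> ?p x" "g x0 = ?p x0"
    using Hahn_Banach by metis
  have le: "?p x \<le> norm x" for x using infdist_le[OF subspace_0[OF V], of x] by simp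
  have bd: "norm (g x) \<le> norm x * 1" for x
    using g(2)[of x] g(2)[of "-x"] linear_neg[OF g(1), of x] le[of x] le[of "-x"] by (simp add: abs_le_iff)
  have bl: "bounded_linear g"
    by (rule bounded_linear_intro[OF _ _ bd]) (use g(1) in \<open>auto simp: linear_add linear_cmul\<close>)
  show ?thesis
  proof (rule that[of "Blinfun g"])
    fix x assume x: "x \<in> V"
    then have "- x \<in> V" using V by (simp add: subspace_neg)
    then show "Blinfun g x = 0"
      using g(2)[of x] g(2)[of "-x"] linear_neg[OF g(1), of x] x
      by (simp add: bounded_linear_Blinfun_apply[OF bl])
  next
    have "?p x0 \<noteq> 0" using x0 in_closure_iff_infdist_zero[OF ne, of x0] by simp
    then show "Blinfun g x0 \<noteq> 0" by (simp add: bounded_linear_Blinfun_apply[OF bl] g)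
  qed
qed

section \<open>Separable reflexive spaces\<close>

lemma bidual_embedding_apply: "blinfun_apply (bidual_embedding x) f = blinfun_apply f x"
proof -
  have "bounded_linear (\<lambda>f. blinfun_apply f x)" by (rule bounded_linear_apply_blinfun)
  then show ?thesis by (simp add: bidual_embedding_def bounded_linear_Blinfun_apply)
qed

text \<open>Countable data replacing the topology: \<open>f\<close> recovers the norm as a supremum,
  so closed balls are countable intersections of half-spaces; \<open>d\<close> yields a countable
  base of balls; by \<open>total\<close> and \<open>reflexive\<close>, a bounded sequence converges
  weakly once it converges along each \<open>f j\<close>.\<close>

locale separable_reflexive =
  fixes f :: "nat \<Rightarrow> 'a::banach \<Rightarrow>\<^sub>L real" and d :: "nat \<Rightarrow> 'a"
  assumes dense: "closure (range d) = UNIV"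
    and norm_f: "norm (f j) \<le> 1"
    and norming: "(\<And>j. f j x \<le> r) \<Longrightarrow> norm x \<le> r"
    and total: "closure (span (range f)) = UNIV"
    and reflexive: "\<exists>x::'a. \<forall>g :: 'a \<Rightarrow>\<^sub>L real. blinfun_apply \<phi> g = blinfun_apply g x"

text \<open>Each \<open>f j\<close> is chosen to attain the norm of \<open>d j\<close>; density of
  the \<open>d j\<close> makes the sequence norming.\<close>

lemma ex_separable_reflexive:
  assumes sep: "separable_space TYPE('a::banach)" and refl: "reflexive_space TYPE('a)"
  shows "\<exists>(f :: nat \<Rightarrow> 'a \<Rightarrow>\<^sub>L real) d. separable_reflexive f d"
proof -
  obtain D :: "'a set" where D: "countable D" "closure D = UNIV" using sep by (auto simp: separable_space_def)
  then have "D \<noteq> {}" by auto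
  define d where "d = from_nat_into D"
  have range_d: "range d = D" unfolding d_def using D \<open>D \<noteq> {}\<close> by (simp add: range_from_nat_into)
  have "\<forall>j. \<exists>f :: 'a \<Rightarrow>\<^sub>L real. norm f \<le> 1 \<and> blinfun_apply f (d j) = norm (d j)"
    using Hahn_Banach_norm by metis
  then obtain f :: "nat \<Rightarrow> 'a \<Rightarrow>\<^sub>L real" where f: "\<And>j. norm (f j) \<le> 1" "\<And>j. f j (d j) = norm (d j)"
    by metis
  have norming: "norm x \<le> r" if r: "\<And>j. f j x \<le> r" for x r
  proof (rule field_le_epsilon)
    fix e :: real assume e: "e > 0"
    have "x \<in> closure (range d)" using D range_d by simp
    then obtain j where j: "dist (d j) x < e/2"
      using e by (metis closure_approachable half_gt_zero rangeE)
    have "norm x \<le> norm (d j) + dist (d j) x" 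
      by (metis dist_norm norm_minus_commute norm_triangle_sub)
    also have "norm (d j) = f j x + f j (d j - x)" using f(2)[of j] by (simp add: blinfun.diff_right)
    also have "f j (d j - x) \<le> norm (f j) * norm (d j - x)" using norm_blinfun[of "f j" "d j - x"] by simp
    also have "\<dots> \<le> 1 * norm (d j - x)" by (rule mult_right_mono) (use f(1) in auto)
    finally show "norm x \<le> r + e" using r[of j] j by (simp add: dist_norm)
  qed
  have refl': "\<exists>x::'a. \<forall>g :: 'a \<Rightarrow>\<^sub>L real. blinfun_apply \<phi> g = blinfun_apply g x" for \<phi>
  proof -
    obtain x where "\<phi> = bidual_embedding x" using refl unfolding reflexive_space_def by (metis surjD)
    then show ?thesis by (auto simp: bidual_embedding_apply)
  qed
  \<comment> \<open>A bidual functional separating \<open>g\<close> from the closed span is, by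
    reflexivity, evaluation at a point; since all \<open>f j\<close> vanish there, that point is
    zero.\<close>
  have "g \<in> closure (span (range f))" for g
  proof (rule ccontr)
    assume "g \<notin> closure (span (range f))"
    then obtain \<phi> :: "('a \<Rightarrow>\<^sub>L real) \<Rightarrow>\<^sub>L real" where \<phi>: "\<And>h. h \<in> span (range f) \<Longrightarrow> \<phi> h = 0" "\<phi> g \<noteq> 0"
      using Hahn_Banach_annihilator[OF subspace_span] by metis
    obtain x where x: "\<And>g. \<phi> g = blinfun_apply g x" using refl' by blast
    have "norm x \<le> 0" by (rule norming) (use \<phi>(1)[of "f _"] x in \<open>simp add: span_base\<close>)
    then show False using \<phi>(2) x by simp
  qed
  then show ?thesis
    by (intro exI[of _ f] exI[of _ d] separable_reflexive.intro) (use D range_d f norming refl' in auto)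
qed

context separable_reflexive
begin

lemma abs_functional_le: "\<bar>f j x\<bar> \<le> norm x"
  using norm_blinfun[of "f j" x] mult_right_mono[OF norm_f norm_ge_zero, of j x] by simp

text \<open>The functionals converging along a bounded sequence form a norm-closed subspace, which
  is the whole dual by \<open>total\<close>. Their limits define a bounded functional on the dual,
  which reflexivity turns into a point.\<close>

lemma weakly_convergent:
  assumes bdd: "\<And>n. norm (y n) \<le> r" and conv: "\<And>j. convergent (\<lambda>n. blinfun_apply (f j) (y n))"
  shows "\<exists>x. \<forall>g :: 'a \<Rightarrow>\<^sub>L real. (\<lambda>n. g (y n)) \<longlonglongrightarrow> g x"
proof -
  let ?S = "{g :: 'a \<Rightarrow>\<^sub>L real. convergent (\<lambda>n. g (y n))}"
  have r: "r \<ge> 0" using bdd[of 0] norm_ge_zero order_trans by blast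
  have sub: "subspace ?S"
    unfolding subspace_def
    by (auto simp: blinfun.add_left blinfun.scaleR_left convergent_const
        intro!: convergent_add convergent_mult)
  have S: "span (range f) \<subseteq> ?S" by (rule span_minimal[OF _ sub]) (use conv in auto)
  have all: "convergent (\<lambda>n. g (y n))" for g :: "'a \<Rightarrow>\<^sub>L real"
  proof -
    have "Cauchy (\<lambda>n. g (y n))"
    proof (rule metric_CauchyI)
      fix e :: real assume e: "e > 0"
      have "g \<in> closure (span (range f))" using total by simp
      \<comment> \<open>Replacing \<open>g\<close> by \<open>h\<close> twice and the Cauchy estimate
        for \<open>h\<close> cost \<open>e/3\<close> each; \<open>r + 1\<close> avoids division by
        zero when \<open>r = 0\<close>.\<close>
      then obtain h where h: "h \<in> span (range f)" "dist h g < e / (3 * (r + 1))"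
        using e r unfolding closure_approachable by (metis add_nonneg_pos divide_pos_pos mult_pos_pos zero_less_numeral zero_less_one)
      have near: "\<bar>g (y n) - h (y n)\<bar> < e / 3" for n
      proof -
        have "\<bar>g (y n) - h (y n)\<bar> = norm ((g - h) (y n))" by (simp add: blinfun.diff_left)
        also have "\<dots> \<le> norm (g - h) * norm (y n)" by (rule norm_blinfun)
        also have "\<dots> \<le> norm (g - h) * (r + 1)" using bdd[of n] by (intro mult_left_mono) auto
        also have "\<dots> < e / (3 * (r + 1)) * (r + 1)"
          using h(2) r by (intro mult_strict_right_mono) (auto simp: dist_norm norm_minus_commute)
        also have "\<dots> = e / 3" using r by (simp add: field_simps)
        finally show ?thesis .
      qed
      have "Cauchy (\<lambda>n. h (y n))" using S h(1) convergent_Cauchy by blast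
      then obtain N where N: "\<And>m n. m \<ge> N \<Longrightarrow> n \<ge> N \<Longrightarrow> dist (h (y m)) (h (y n)) < e/3"
        using e by (metis metric_CauchyD zero_less_divide_iff zero_less_numeral)
      show "\<exists>M. \<forall>m\<ge>M. \<forall>n\<ge>M. dist (g (y m)) (g (y n)) < e"
      proof (intro exI[of _ N] allI impI)
        fix m n assume "m \<ge> N" "n \<ge> N"
        then show "dist (g (y m)) (g (y n)) < e"
          using near[of m] near[of n] N[of m n] unfolding dist_real_def by linarith
      qed
    qed
    then show ?thesis by (simp add: Cauchy_convergent_iff)
  qed
  define l where "l g = lim (\<lambda>n. blinfun_apply g (y n))" for g :: "'a \<Rightarrow>\<^sub>L real"
  have l: "(\<lambda>n. blinfun_apply g (y n)) \<longlonglongrightarrow> l g" for g using all unfolding l_def by (simp add: convergent_LIMSEQ_iff)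
  have "bounded_linear l"
  proof (rule bounded_linear_intro)
    fix g h show "l (g + h) = l g + l h"
      by (rule LIMSEQ_unique[OF l]) (use tendsto_add[OF l l] in \<open>simp add: blinfun.add_left\<close>)
  next
    fix c g show "l (c *\<^sub>R g) = c *\<^sub>R l g"
      by (rule LIMSEQ_unique[OF l]) (use tendsto_scaleR[OF tendsto_const l] in \<open>simp add: blinfun.scaleR_left\<close>)
  next
    fix g :: "'a \<Rightarrow>\<^sub>L real"
    have "norm (blinfun_apply g (y n)) \<le> norm g * r" for n
      using norm_blinfun[of g "y n"] mult_left_mono[OF bdd[of n], of "norm g"] by simp
    then show "norm (l g) \<le> norm g * r"
      by (intro LIMSEQ_le_const2[OF tendsto_norm[OF l]]) auto
  qed
  then have "l g = Blinfun l g" for g by (simp add: bounded_linear_Blinfun_apply)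
  then obtain x where "\<And>g. l g = blinfun_apply g x" using reflexive[of "Blinfun l"] by metis
  then show ?thesis using l by auto
qed

text \<open>A closed ball is an intersection of half-spaces of the norming functionals, hence weakly
  closed.\<close>

lemma norm_le_weak_limit:
  assumes lim: "\<And>g :: 'a \<Rightarrow>\<^sub>L real. (\<lambda>n. g (y n)) \<longlonglongrightarrow> g x"
    and ev: "\<forall>\<^sub>F n in sequentially. norm (y n - a) \<le> r"
  shows "norm (x - a) \<le> r"
proof (rule norming)
  fix j
  have "\<forall>\<^sub>F n in sequentially. f j (y n) - f j a \<le> r"
    using ev
  proof eventually_elim
    case (elim n)
    then show ?case using abs_functional_le[of j "y n - a"] by (simp add: blinfun.diff_right)
  qed
  then have "f j x - f j a \<le> r"
    by (intro tendsto_upperbound[OF tendsto_diff[OF lim tendsto_const]]) auto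
  then show "f j (x - a) \<le> r" by (simp add: blinfun.diff_right)
qed

lemma functionals_eqI:
  assumes "\<And>j. blinfun_apply (f j) x = f j y" shows "x = y"
proof -
  have "norm (x - y) \<le> 0" by (rule norming) (use assms in \<open>simp add: blinfun.diff_right\<close>)
  then show ?thesis by simp
qed

lemma open_contains_cball_dense:
  assumes "open U" "x \<in> U"
  obtains i q where "q \<in> \<rat>" "q > 0" "x \<in> cball (d i) q" "cball (d i) q \<subseteq> U"
proof -
  obtain e where e: "e > 0" "ball x e \<subseteq> U" using assms openE by blast
  obtain q where q: "q \<in> \<rat>" "0 < q" "q < e/2" using Rats_dense_in_real[of 0 "e/2"] e by auto
  have "x \<in> closure (range d)" using dense by simp
  then obtain i where i: "dist (d i) x < q" using q(2) by (metis closure_approachable rangeE)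
  have "cball (d i) q \<subseteq> ball x e"
  proof
    fix z assume "z \<in> cball (d i) q"
    then show "z \<in> ball x e" using i q dist_triangle[of x z "d i"] by (simp add: dist_commute)
  qed
  then have "cball (d i) q \<subseteq> U" using e by blast
  moreover have "x \<in> cball (d i) q" using i by simp
  ultimately show ?thesis using that[of q i] q by blast
qed

text \<open>The \<open>f j\<close> generate the Borel sets: a closed ball is a countable
  intersection of their half-spaces, and an open set is a countable union of balls with centres
  \<open>d i\<close> and rational radii.\<close>

lemma measurable_functionals:
  assumes g: "\<And>j. (\<lambda>\<omega>. blinfun_apply (f j) (g \<omega>)) \<in> borel_measurable M"
  shows "g \<in> measurable M borel"
proof (rule borel_measurableI)
  fix U :: "'a set" assume U: "open U"
  note g[measurable]
  let ?I = "{(i, q). q \<in> \<rat> \<and> cball (d i) q \<subseteq> U}"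
  have c: "countable ?I"
    by (rule countable_subset[of _ "UNIV \<times> \<rat>"]) (auto intro: countable_rat)
  have U_eq: "U = (\<Union>(i, q)\<in>?I. cball (d i) q)"
  proof (intro equalityI subsetI)
    fix x assume "x \<in> U"
    then obtain i q where "q \<in> \<rat>" "x \<in> cball (d i) q" "cball (d i) q \<subseteq> U"
      using open_contains_cball_dense[OF U] by metis
    then show "x \<in> (\<Union>(i, q)\<in>?I. cball (d i) q)" by blast
  qed auto
  have eq: "g -` U \<inter> space M = (\<Union>(i, q)\<in>?I. g -` cball (d i) q \<inter> space M)"
    by (subst U_eq) auto
  have "g -` cball a q \<inter> space M \<in> sets M" for a q
  proof -
    have "x \<in> cball a q \<longleftrightarrow> (\<forall>j. f j (x - a) \<le> q)" for x
    proof
      assume x: "x \<in> cball a q"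
      show "\<forall>j. f j (x - a) \<le> q"
      proof
        fix j show "f j (x - a) \<le> q"
          using x abs_functional_le[of j "x - a"] by (simp add: dist_norm norm_minus_commute)
      qed
    next
      assume "\<forall>j. f j (x - a) \<le> q"
      then have "norm (x - a) \<le> q" by (intro norming) auto
      then show "x \<in> cball a q" by (simp add: dist_norm norm_minus_commute)
    qed
    then have "g -` cball a q \<inter> space M = {\<omega>\<in>space M. \<forall>j. f j (g \<omega>) - f j a \<le> q}"
      by (auto simp: blinfun.diff_right)
    also have "\<dots> \<in> sets M" by measurable
    finally show ?thesis .
  qed
  then show "g -` U \<inter> space M \<in> sets M" unfolding eq using c by (intro sets.countable_UN'') auto
qed

end

section \<open>Limits of empirical measures on the Cantor space\<close>

definition cylinders :: "('i \<Rightarrow> bool) set set" where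
  "cylinders = {C. \<exists>J. finite J \<and> (\<forall>\<omega> \<omega>'. (\<forall>j\<in>J. \<omega> j = \<omega>' j) \<longrightarrow> (\<omega> \<in> C \<longleftrightarrow> \<omega>' \<in> C))}"

lemma cylindersE:
  assumes "C \<in> cylinders"
  obtains J where "finite J" "\<And>\<omega> \<omega>'. \<forall>j\<in>J. \<omega> j = \<omega>' j \<Longrightarrow> \<omega> \<in> C \<longleftrightarrow> \<omega>' \<in> C"
proof -
  obtain J where J: "finite J" "\<forall>\<omega> \<omega>'. (\<forall>j\<in>J. \<omega> j = \<omega>' j) \<longrightarrow> (\<omega> \<in> C \<longleftrightarrow> \<omega>' \<in> C)"
    using assms unfolding cylinders_def by auto
  show ?thesis by (rule that[OF J(1)]) (use J(2) in simp)
qed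

lemma cylindersI:
  fixes C :: "('i \<Rightarrow> bool) set"
  assumes "finite J" "\<And>\<omega> \<omega>'. \<forall>j\<in>J. \<omega> j = \<omega>' j \<Longrightarrow> \<omega> \<in> C \<Longrightarrow> \<omega>' \<in> C"
  shows "C \<in> cylinders"
proof -
  have "\<omega> \<in> C \<longleftrightarrow> \<omega>' \<in> C" if "\<forall>j\<in>J. \<omega> j = \<omega>' j" for \<omega> \<omega>' :: "'i \<Rightarrow> bool"
    using assms(2)[of \<omega> \<omega>'] assms(2)[of \<omega>' \<omega>] that by auto
  then show ?thesis using assms(1) unfolding cylinders_def by blast
qed

lemma algebra_cylinders: "algebra UNIV cylinders"
  unfolding algebra_iff_Un
proof (intro conjI ballI)
  show "{} \<in> cylinders" by (rule cylindersI[of "{}"]) auto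
next
  fix C :: "('i \<Rightarrow> bool) set" assume "C \<in> cylinders"
  then obtain J where J: "finite J" "\<And>\<omega> \<omega>'. \<forall>j\<in>J. \<omega> j = \<omega>' j \<Longrightarrow> \<omega> \<in> C \<longleftrightarrow> \<omega>' \<in> C"
    using cylindersE by metis
  show "UNIV - C \<in> cylinders" by (rule cylindersI[OF J(1)]) (use J(2) in blast)
next
  fix C D :: "('i \<Rightarrow> bool) set" assume C: "C \<in> cylinders" and D: "D \<in> cylinders"
  from C obtain J where J: "finite J" "\<And>\<omega> \<omega>'. \<forall>j\<in>J. \<omega> j = \<omega>' j \<Longrightarrow> \<omega> \<in> C \<longleftrightarrow> \<omega>' \<in> C"
    using cylindersE by metis
  from D obtain K where K: "finite K" "\<And>\<omega> \<omega>'. \<forall>j\<in>K. \<omega> j = \<omega>' j \<Longrightarrow> \<omega> \<in> D \<longleftrightarrow> \<omega>' \<in> D"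
    using cylindersE by metis
  show "C \<union> D \<in> cylinders"
  proof (rule cylindersI[of "J \<union> K"])
    fix \<omega> \<omega>' :: "'i \<Rightarrow> bool" assume eq: "\<forall>j\<in>J \<union> K. \<omega> j = \<omega>' j" and "\<omega> \<in> C \<union> D"
    moreover have "\<omega> \<in> C \<longleftrightarrow> \<omega>' \<in> C" by (rule J(2)) (use eq in auto)
    moreover have "\<omega> \<in> D \<longleftrightarrow> \<omega>' \<in> D" by (rule K(2)) (use eq in auto)
    ultimately show "\<omega>' \<in> C \<union> D" by blast
  qed (use J K in auto)
qed auto

interpretation cyl: algebra UNIV "cylinders :: ('i \<Rightarrow> bool) set set"
  by (rule algebra_cylinders)

lemma Int_stable_cylinders: "Int_stable cylinders"
  by (auto simp: Int_stable_def)

text \<open>A cylinder is recovered from a finite \<open>J\<close> and the finite family of traces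
  \<open>{j\<in>J. \<omega> j}\<close> of its points. Countability is what the diagonal argument
  needs.\<close>

lemma countable_cylinders: "countable (cylinders :: ('i::countable \<Rightarrow> bool) set set)"
proof -
  let ?fin = "{J :: 'i set. finite J}"
  let ?h = "\<lambda>(J :: 'i set, F). {\<omega>. {j\<in>J. \<omega> j} \<in> F}"
  have "(C :: ('i \<Rightarrow> bool) set) \<in> ?h ` (?fin \<times> {F. finite F \<and> F \<subseteq> ?fin})" if C: "C \<in> cylinders" for C
  proof -
    obtain J where J: "finite J" "\<And>\<omega> \<omega>'. \<forall>j\<in>J. \<omega> j = \<omega>' j \<Longrightarrow> \<omega> \<in> C \<longleftrightarrow> \<omega>' \<in> C"
      using cylindersE[OF C] by metis
    let ?F = "(\<lambda>\<omega>. {j\<in>J. \<omega> j}) ` C"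
    have "\<omega> \<in> C" if "{j\<in>J. \<omega> j} \<in> ?F" for \<omega>
    proof -
      obtain \<omega>' where "\<omega>' \<in> C" "{j\<in>J. \<omega> j} = {j\<in>J. \<omega>' j}" using \<open>{j\<in>J. \<omega> j} \<in> ?F\<close> by blast
      moreover have "\<omega> j = \<omega>' j" if "j \<in> J" for j using calculation(2) that by blast
      ultimately show ?thesis using J(2)[of \<omega> \<omega>'] by blast
    qed
    then have "\<omega> \<in> C \<longleftrightarrow> {j\<in>J. \<omega> j} \<in> ?F" for \<omega> by blast
    then have "C = {\<omega>. {j\<in>J. \<omega> j} \<in> ?F}" by (intro set_eqI) (simp only: mem_Collect_eq)
    then have C_eq: "C = ?h (J, ?F)" by (simp only: prod.case)
    have "finite ?F" by (rule finite_subset[of _ "Pow J"]) (use J(1) in auto)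
    moreover have "?F \<subseteq> ?fin" using J(1) by auto
    ultimately have "(J, ?F) \<in> ?fin \<times> {F. finite F \<and> F \<subseteq> ?fin}" using J(1) by blast
    with C_eq show ?thesis by (rule image_eqI)
  qed
  then have sub: "cylinders \<subseteq> ?h ` (?fin \<times> {F. finite F \<and> F \<subseteq> ?fin})" by blast
  show ?thesis
    by (rule countable_subset[OF sub])
      (intro countable_image countable_SIGMA countable_Collect_finite_subset countable_Collect_finite)
qed

lemma open_cylinder:
  assumes "C \<in> cylinders" shows "open C"
proof -
  obtain J where J: "finite J" "\<And>\<omega> \<omega>'. \<forall>j\<in>J. \<omega> j = \<omega>' j \<Longrightarrow> \<omega> \<in> C \<longleftrightarrow> \<omega>' \<in> C"
    using cylindersE[OF assms] by metis
  have o: "open {\<omega>' :: 'a \<Rightarrow> bool. \<omega>' j = b}" for j b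
  proof -
    have "open ((\<lambda>\<omega>'. \<omega>' j) -` {b} :: ('a \<Rightarrow> bool) set)"
      by (rule open_vimage[OF discrete_topology_class.open_discrete continuous_on_product_coordinates])
    then show ?thesis by (simp add: vimage_def)
  qed
  have "C = (\<Union>\<omega>\<in>C. \<Inter>j\<in>J. {\<omega>'. \<omega>' j = \<omega> j})"
  proof (intro equalityI subsetI)
    fix \<omega>' assume "\<omega>' \<in> (\<Union>\<omega>\<in>C. \<Inter>j\<in>J. {\<omega>'. \<omega>' j = \<omega> j})"
    then obtain \<omega> where "\<omega> \<in> C" "\<And>j. j \<in> J \<Longrightarrow> \<omega>' j = \<omega> j" by auto
    then show "\<omega>' \<in> C" using J(2)[of \<omega>' \<omega>] by blast
  qed auto
  also have "open \<dots>" by (intro open_UN ballI open_INT J(1) o)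
  finally show ?thesis .
qed

lemma compact_UNIV_bool_fun: "compact (UNIV :: ('i \<Rightarrow> bool) set)"
proof -
  have "compactin (product_topology (\<lambda>i::'i. euclidean :: bool topology) UNIV) (PiE UNIV (\<lambda>i. UNIV))"
    unfolding compactin_PiE by (simp add: finite_imp_compact)
  then show ?thesis by (simp add: euclidean_product_topology PiE_UNIV_domain)
qed

text \<open>Cylinders are closed in a compact space, so a decreasing sequence of nonempty ones has a
  common point. This is the continuity at the empty set that Caratheodory's theorem asks
  for.\<close>

lemma decseq_cylinders_empty:
  fixes A :: "nat \<Rightarrow> ('i \<Rightarrow> bool) set"
  assumes A: "range A \<subseteq> cylinders" "decseq A" "(\<Inter>i. A i) = {}"
  shows "\<exists>i. A i = {}"
proof (rule ccontr)
  assume ne: "\<nexists>i. A i = {}"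
  have "UNIV \<inter> \<Inter>(range A) \<noteq> {}"
  proof (rule compact_imp_fip[OF compact_UNIV_bool_fun])
    fix T assume "T \<in> range A"
    then have "UNIV - T \<in> cylinders" using A(1) by auto
    then show "closed T" using open_cylinder by (auto simp: closed_def Compl_eq_Diff_UNIV)
  next
    fix F assume F: "finite F" "F \<subseteq> range A"
    then obtain I where I: "finite I" "F = A ` I" by (meson finite_subset_image)
    \<comment> \<open>\<open>insert 0\<close> gives the maximum a meaning when the finite subfamily
      is empty.\<close>
    have "A (Max (insert 0 I)) \<subseteq> A i" if "i \<in> I" for i
      using I(1) that by (intro decseqD[OF A(2)] Max_ge) auto
    then have "A (Max (insert 0 I)) \<subseteq> \<Inter>F" using I by auto
    then show "UNIV \<inter> \<Inter>F \<noteq> {}" using ne by blast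
  qed
  then show False using A(3) by simp
qed

section \<open>Empirical frequencies and their limits\<close>

definition freq :: "(nat \<Rightarrow> 'b) \<Rightarrow> nat \<Rightarrow> 'b set \<Rightarrow> real" where
  "freq c N C = real (card {n\<in>{1..N}. c n \<in> C}) / real N"

lemma freq_nonneg: "freq c N C \<ge> 0"
  by (simp add: freq_def)

lemma freq_le_1: "freq c N C \<le> 1"
proof -
  have "card {n\<in>{1..N}. c n \<in> C} \<le> card {1..N}" by (rule card_mono) auto
  then show ?thesis by (simp add: freq_def divide_le_eq)
qed

lemma freq_Un_disjoint:
  assumes "C \<inter> D = {}" shows "freq c N (C \<union> D) = freq c N C + freq c N D"
proof -
  have "{n\<in>{1..N}. c n \<in> C \<union> D} = {n\<in>{1..N}. c n \<in> C} \<union> {n\<in>{1..N}. c n \<in> D}" by auto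
  then have "card {n\<in>{1..N}. c n \<in> C \<union> D} = card {n\<in>{1..N}. c n \<in> C} + card {n\<in>{1..N}. c n \<in> D}"
    using assms by (auto intro!: card_Un_disjoint)
  then show ?thesis by (simp add: freq_def add_divide_distrib)
qed

lemma freq_UNIV: "N > 0 \<Longrightarrow> freq c N UNIV = 1"
proof -
  have "{n\<in>{1..N}. c n \<in> UNIV} = {1..N}" by auto
  then show "N > 0 \<Longrightarrow> freq c N UNIV = 1" by (simp add: freq_def del: Collect_conj_eq)
qed

text \<open>The windows \<open>1..N\<close> and \<open>2..N+1\<close> differ in one index at each
  end, so the counts differ by at most one; this makes the limit measure shift invariant.\<close>

lemma freq_shift_diff:
  "\<bar>freq (\<lambda>n. c (Suc n)) N C - freq c N C\<bar> \<le> 1 / real N"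
proof -
  let ?a = "{n\<in>{1..N}. c (Suc n) \<in> C}" and ?b = "{n\<in>{1..N}. c n \<in> C}"
  have "card ?a = card (Suc ` ?a)" by (simp add: card_image)
  also have "\<dots> \<le> card (insert (Suc N) ?b)" by (rule card_mono) (auto simp: le_Suc_eq)
  also have "\<dots> \<le> Suc (card ?b)" by (rule card_insert_le_m1) auto
  finally have 1: "card ?a \<le> card ?b + 1" by simp
  have "card ?b \<le> card (insert 1 (Suc ` ?a))"
  proof (rule card_mono)
    show "?b \<subseteq> insert 1 (Suc ` ?a)"
    proof
      fix n assume n: "n \<in> ?b"
      show "n \<in> insert 1 (Suc ` ?a)"
      proof (cases "n = 1")
        case False
        then have "n = Suc (n - 1)" "n - 1 \<in> ?a" using n by auto
        then show ?thesis by blast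
      qed simp
    qed
  qed simp
  also have "\<dots> \<le> Suc (card (Suc ` ?a))" by (rule card_insert_le_m1) auto
  finally have 2: "card ?b \<le> card ?a + 1" by (simp add: card_image)
  have "\<bar>real (card ?a) - real (card ?b)\<bar> \<le> 1" using 1 2 by linarith
  then have "\<bar>real (card ?a) - real (card ?b)\<bar> / real N \<le> 1 / real N" by (intro divide_right_mono) auto
  then show ?thesis by (simp add: freq_def abs_divide flip: diff_divide_distrib)
qed

lemma ex_subseq_freq_convergent:
  assumes "countable \<C>"
  obtains r :: "nat \<Rightarrow> nat" where "strict_mono r" "\<And>C. C \<in> \<C> \<Longrightarrow> convergent (\<lambda>k. freq c (r k) C)"
proof -
  \<comment> \<open>\<open>insert {}\<close> makes the family nonempty, so that it has an
    enumeration.\<close>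
  define A where "A = from_nat_into (insert {} \<C>)"
  interpret subseqs "\<lambda>n s. convergent (\<lambda>k. freq c (s k) (A n))"
  proof
    fix n and s :: "nat \<Rightarrow> nat"
    have "\<forall>k. freq c (s k) (A n) \<in> {0..1}" by (simp add: freq_nonneg freq_le_1)
    then obtain l r where "strict_mono (r :: nat \<Rightarrow> nat)" "((\<lambda>k. freq c (s k) (A n)) \<circ> r) \<longlonglongrightarrow> l"
      using compact_Icc[of "0::real" 1] unfolding compact_eq_seq_compact_metric seq_compact_def by metis
    then show "\<exists>r'. strict_mono r' \<and> convergent (\<lambda>k. freq c ((s \<circ> r') k) (A n))"
      by (auto simp: o_def convergent_def)
  qed
  have "convergent (\<lambda>k. freq c (diagseq k) (A n))" for n
  proof -
    \<comment> \<open>Only the terms of the diagonal sequence from index \<open>Suc n\<close> on are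
      known to come from the \<open>n\<close>-th subsequence; convergence ignores the
      others.\<close>
    have "convergent (\<lambda>k. freq c ((diagseq \<circ> (+) (Suc n)) k) (A n))"
    proof (rule diagseq_holds)
      fix r s :: "nat \<Rightarrow> nat" and n
      assume "strict_mono r" "convergent (\<lambda>k. freq c (s k) (A n))"
      then show "convergent (\<lambda>k. freq c ((s \<circ> r) k) (A n))"
        using convergent_subseq_convergent[of "\<lambda>k. freq c (s k) (A n)" r] by (simp add: o_def)
    qed
    then have "convergent (\<lambda>k. freq c (diagseq (k + Suc n)) (A n))" by (simp add: o_def add.commute)
    then show ?thesis by (subst (asm) convergent_ignore_initial_segment)
  qed
  moreover have "\<exists>n. A n = C" if "C \<in> \<C>" for C
    unfolding A_def using assms that by (intro from_nat_into_surj) auto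
  ultimately show ?thesis using that[OF subseq_diagseq] by metis
qed

text \<open>Limit frequencies are finitely additive on cylinders, and compactness makes them
  continuous at the empty set, so Caratheodory's theorem extends them.\<close>

theorem ex_empirical_limit_measure:
  fixes c :: "nat \<Rightarrow> 'i::countable \<Rightarrow> bool"
  obtains r :: "nat \<Rightarrow> nat" and P where "strict_mono r" "prob_space P" "sets P = sigma_sets UNIV cylinders"
    "\<And>C. C \<in> cylinders \<Longrightarrow> (\<lambda>k. freq c (r k) C) \<longlonglongrightarrow> measure P C"
proof -
  obtain r :: "nat \<Rightarrow> nat" where r: "strict_mono r"
    and conv: "\<And>C. C \<in> cylinders \<Longrightarrow> convergent (\<lambda>k. freq c (r k) C)"
    using ex_subseq_freq_convergent[OF countable_cylinders] by metis
  define \<rho> where "\<rho> C = lim (\<lambda>k. freq c (r k) C)" for C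
  have \<rho>: "(\<lambda>k. freq c (r k) C) \<longlonglongrightarrow> \<rho> C" if "C \<in> cylinders" for C
    using conv[OF that] unfolding \<rho>_def by (simp add: convergent_LIMSEQ_iff)
  have nonneg: "\<rho> C \<ge> 0" if "C \<in> cylinders" for C
    by (rule LIMSEQ_le_const[OF \<rho>[OF that]]) (simp add: freq_nonneg)
  have empty: "\<rho> {} = 0" unfolding \<rho>_def freq_def by simp
  have add: "\<rho> (C \<union> D) = \<rho> C + \<rho> D" if "C \<in> cylinders" "D \<in> cylinders" "C \<inter> D = {}" for C D
    by (rule LIMSEQ_unique[OF \<rho>]) (use that tendsto_add[OF \<rho> \<rho>, of C D] in \<open>auto simp: freq_Un_disjoint\<close>)
  have "\<exists>\<mu> :: ('i \<Rightarrow> bool) set \<Rightarrow> ennreal. (\<forall>s\<in>cylinders. \<mu> s = ennreal (\<rho> s)) \<and>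
      measure_space UNIV (sigma_sets UNIV cylinders) \<mu>"
  proof (rule cyl.caratheodory_empty_continuous)
    show "positive cylinders (\<lambda>s. ennreal (\<rho> s))" by (simp add: positive_def empty)
    show "additive cylinders (\<lambda>s. ennreal (\<rho> s))"
      by (auto simp: additive_def add nonneg ennreal_plus)
    fix A :: "nat \<Rightarrow> ('i \<Rightarrow> bool) set"
    assume A: "range A \<subseteq> cylinders" "decseq A" "(\<Inter>i. A i) = {}"
    then obtain i where i: "A i = {}" using decseq_cylinders_empty by blast
    have "A j = {}" if "j \<ge> i" for j using decseqD[OF A(2) that] i by auto
    then show "(\<lambda>i. ennreal (\<rho> (A i))) \<longlonglongrightarrow> 0"
      by (intro tendsto_eventually eventually_sequentiallyI[of i]) (simp add: empty)
  qed simp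
  then obtain \<mu> :: "('i \<Rightarrow> bool) set \<Rightarrow> ennreal" where \<mu>: "\<And>s. s \<in> cylinders \<Longrightarrow> \<mu> s = ennreal (\<rho> s)"
    and ms: "measure_space UNIV (sigma_sets UNIV cylinders) \<mu>" by auto
  define P where "P = measure_of UNIV cylinders \<mu>"
  have sets: "sets P = sigma_sets UNIV cylinders" and space: "space P = UNIV"
    by (auto simp: P_def)
  have em: "emeasure P C = ennreal (\<rho> C)" if "C \<in> cylinders" for C
  proof -
    have "emeasure P C = \<mu> C"
      by (rule emeasure_measure_of[OF P_def]) (use ms that in \<open>auto simp: measure_space_def sets\<close>)
    then show ?thesis using \<mu>[OF that] by simp
  qed
  have "(\<lambda>k. freq c (r k) UNIV) \<longlonglongrightarrow> 1"
  proof (rule tendsto_eventually)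
    \<comment> \<open>\<open>freq c 0 UNIV\<close> is 0, not 1; strict monotonicity of
      \<open>r\<close> excludes \<open>r k = 0\<close> once \<open>k \<ge> 1\<close>.\<close>
    have "freq c (r k) UNIV = 1" if "k \<ge> 1" for k
      using seq_suble[OF r, of k] that by (intro freq_UNIV) simp
    then show "\<forall>\<^sub>F k in sequentially. freq c (r k) UNIV = 1" by (rule eventually_sequentiallyI)
  qed
  then have "\<rho> UNIV = 1" using LIMSEQ_unique \<rho>[of UNIV] cyl.top by blast
  then have "prob_space P" using em[of UNIV] space by (intro prob_spaceI) (simp add: cyl.top[simplified])
  moreover have "measure P C = \<rho> C" if "C \<in> cylinders" for C
    using em[OF that] nonneg[OF that] by (simp add: measure_def)
  ultimately show ?thesis using that[OF r _ sets] \<rho> by simp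
qed

section \<open>An invariant measure with full support\<close>

lemma real_rat_between: "a < b \<Longrightarrow> \<exists>q. a < real_of_rat q \<and> real_of_rat q < b"
  using Rats_dense_in_real[of a b] by (auto simp: Rats_def)

lemma borel_measurable_bounded_linear_self:
  assumes "bounded_linear T" shows "T \<in> measurable borel borel"
  by (rule borel_measurable_continuous_onI) (rule linear_continuous_on[OF assms])

section \<open>Invariant measures and conditioning\<close>

definition invariant_prob :: "('a::topological_space \<Rightarrow> 'a) \<Rightarrow> 'a measure \<Rightarrow> bool" where
  "invariant_prob T m \<longleftrightarrow> prob_space m \<and> sets m = sets borel \<and> distr m borel T = m"

text \<open>\<open>G\<close> lies in its preimage under \<open>S\<close>, and invariance gives both
  the same finite measure, so they differ by a null set.\<close>

lemma AE_invariant_subset: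
  assumes "prob_space P" and S[measurable]: "S \<in> measurable P P" and inv: "distr P P S = P"
    and G[measurable]: "G \<in> sets P" and sub: "\<And>\<omega>. \<omega> \<in> G \<Longrightarrow> S \<omega> \<in> G"
  shows "AE \<omega> in P. S \<omega> \<in> G \<longleftrightarrow> \<omega> \<in> G"
proof -
  interpret prob_space P by fact
  let ?D = "(S -` G \<inter> space P) - G"
  have D: "?D \<in> sets P" by measurable
  have "emeasure P (S -` G \<inter> space P) = emeasure (distr P P S) G" by (simp add: emeasure_distr)
  then have eq: "emeasure P (S -` G \<inter> space P) = emeasure P G" by (simp add: inv)
  have "emeasure P ?D = emeasure P (S -` G \<inter> space P) - emeasure P G"
    by (rule emeasure_Diff) (use sub sets.sets_into_space[OF G] in auto)
  then have "?D \<in> null_sets P" using D eq by (auto simp: null_sets_def)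
  then have "AE \<omega> in P. \<omega> \<notin> ?D" by (rule AE_not_in)
  then show ?thesis using AE_space by eventually_elim (use sub in auto)
qed

text \<open>Since \<open>G\<close> agrees with its preimage almost everywhere, intersecting the
  preimage of \<open>A\<close> with \<open>G\<close> amounts to taking the preimage of
  \<open>G \<inter> A\<close>.\<close>

lemma emeasure_uniform_measure_invariant:
  assumes S[measurable]: "S \<in> measurable P P" and inv: "distr P P S = P"
    and G[measurable]: "G \<in> sets P" and ae: "AE \<omega> in P. S \<omega> \<in> G \<longleftrightarrow> \<omega> \<in> G" and A[measurable]: "A \<in> sets P"
  shows "emeasure (uniform_measure P G) (S -` A \<inter> space P) = emeasure (uniform_measure P G) A"
proof -
  have "emeasure P (G \<inter> (S -` A \<inter> space P)) = emeasure P (S -` (G \<inter> A) \<inter> space P)"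
    by (rule emeasure_eq_AE) (use ae AE_space in \<open>eventually_elim, auto\<close>, measurable)
  also have "\<dots> = emeasure (distr P P S) (G \<inter> A)" by (simp add: emeasure_distr)
  finally show ?thesis by (simp add: inv)
qed

section \<open>Codes of points and their weak limits\<close>

locale frequently_hypercyclic_operator = separable_reflexive f d
  for f :: "nat \<Rightarrow> 'a::banach \<Rightarrow>\<^sub>L real" and d +
  fixes T :: "'a \<Rightarrow> 'a" and x0 :: 'a
  assumes bounded_linear_T: "bounded_linear T"
    and freq_pos: "open V \<Longrightarrow> V \<noteq> {} \<Longrightarrow> \<exists>e>0. \<forall>\<^sub>F N in sequentially. e \<le> freq (\<lambda>n. (T ^^ n) x0) N V"
begin

text \<open>The Boolean selects between the two kinds of test sets: \<open>True\<close> for closed balls around the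
  dense sequence, \<open>False\<close> for the half-spaces cut out by the norming functionals.\<close>

definition test_set :: "bool \<times> nat \<times> rat \<Rightarrow> 'a set" where
  "test_set = (\<lambda>(b, i, q). if b then cball (d i) (of_rat q) else {x. f i x \<le> of_rat q})"

definition code :: "'a \<Rightarrow> nat \<times> bool \<times> nat \<times> rat \<Rightarrow> bool" where
  "code x = (\<lambda>(k, i). (T ^^ k) x \<in> test_set i)"

definition shift :: "(nat \<times> bool \<times> nat \<times> rat \<Rightarrow> bool) \<Rightarrow> nat \<times> bool \<times> nat \<times> rat \<Rightarrow> bool" where
  "shift \<omega> = (\<lambda>(k, i). \<omega> (Suc k, i))"

lemma code_T: "code (T x) = shift (code x)"
  by (auto simp: code_def shift_def fun_eq_iff funpow_swap1)

text \<open>A code \<open>\<omega>\<close> need not be the code of any point; it only singles out a point \<open>x\<close> as the weak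
  limit of bounded points whose codes converge to \<open>\<omega>\<close>.\<close>

definition codes_limit :: "(nat \<times> bool \<times> nat \<times> rat \<Rightarrow> bool) \<Rightarrow> 'a \<Rightarrow> bool" where
  "codes_limit \<omega> x \<longleftrightarrow> (\<exists>y. bounded (range y) \<and> (\<forall>p. \<forall>\<^sub>F n in sequentially. code (y n) p = \<omega> p)
     \<and> (\<forall>g :: 'a \<Rightarrow>\<^sub>L real. (\<lambda>n. g (y n)) \<longlonglongrightarrow> g x))"

text \<open>This is the closure, in the product topology, of the set of codes of points.\<close>

definition realizable :: "(nat \<times> bool \<times> nat \<times> rat \<Rightarrow> bool) set" where
  "realizable = {\<omega>. \<forall>J. finite J \<longrightarrow> (\<exists>y. \<forall>p\<in>J. code y p = \<omega> p)}"

text \<open>A ball recorded at time 0 keeps the approximating points bounded; mass that escapes to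
  infinity sits outside this set.\<close>

definition bounded_codes :: "(nat \<times> bool \<times> nat \<times> rat \<Rightarrow> bool) set" where
  "bounded_codes = {\<omega>. \<exists>i q. \<omega> (0, True, i, q)}"

text \<open>True bits survive in the weak limit because the test sets are weakly closed. A false
  half-space bit survives only as a non-strict inequality; a false ball bit gives no information, as
  complements of balls need not be weakly closed.\<close>

lemma codes_limitD:
  assumes "codes_limit \<omega> x"
  shows "\<omega> (0, True, i, q) \<Longrightarrow> x \<in> cball (d i) (of_rat q)"
    and "\<omega> (0, False, i, q) \<Longrightarrow> f i x \<le> of_rat q"
    and "\<not> \<omega> (0, False, i, q) \<Longrightarrow> of_rat q \<le> f i x"
proof -
  obtain y where ev: "\<And>p. \<forall>\<^sub>F n in sequentially. code (y n) p = \<omega> p"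
    and lim: "\<And>g :: 'a \<Rightarrow>\<^sub>L real. (\<lambda>n. g (y n)) \<longlonglongrightarrow> g x"
    using assms unfolding codes_limit_def by blast
  show "x \<in> cball (d i) (of_rat q)" if "\<omega> (0, True, i, q)"
  proof -
    have "\<forall>\<^sub>F n in sequentially. norm (y n - d i) \<le> of_rat q"
      using ev[of "(0, True, i, q)"]
      by eventually_elim (use that in \<open>simp add: code_def test_set_def dist_norm norm_minus_commute\<close>)
    from norm_le_weak_limit[OF lim this] show ?thesis by (simp add: dist_norm norm_minus_commute)
  qed
  show "f i x \<le> of_rat q" if "\<omega> (0, False, i, q)"
  proof (rule tendsto_upperbound[OF lim])
    show "\<forall>\<^sub>F n in sequentially. f i (y n) \<le> of_rat q"
      using ev[of "(0, False, i, q)"] by eventually_elim (use that in \<open>simp add: code_def test_set_def\<close>)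
  qed simp
  show "of_rat q \<le> f i x" if "\<not> \<omega> (0, False, i, q)"
  proof (rule tendsto_lowerbound[OF lim])
    show "\<forall>\<^sub>F n in sequentially. of_rat q \<le> f i (y n)"
      using ev[of "(0, False, i, q)"] by eventually_elim (use that in \<open>simp add: code_def test_set_def\<close>)
  qed simp
qed

text \<open>If two limits differed under \<open>f j\<close>, the bit of a half-space with rational
  bound strictly between the two values could be neither true nor false.\<close>

lemma codes_limit_unique:
  assumes x: "codes_limit \<omega> x" and y: "codes_limit \<omega> y"
  shows "x = y"
proof (rule functionals_eqI)
  have "\<not> f j u < f j v" if u: "codes_limit \<omega> u" and v: "codes_limit \<omega> v" for j u v
  proof
    assume "f j u < f j v"
    then obtain q where "f j u < of_rat q" "of_rat q < f j v" using real_rat_between by blast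
    then show False
      using codes_limitD(2)[OF v, of j q] codes_limitD(3)[OF u, of j q] by linarith
  qed
  from this[OF x y] this[OF y x] show "f j x = f j y" for j by (metis linorder_neqE)
qed

text \<open>Bounded operators are weakly continuous, since a functional composed with
  \<open>T\<close> is a functional.\<close>

lemma codes_limit_shift:
  assumes "codes_limit \<omega> x" shows "codes_limit (shift \<omega>) (T x)"
proof -
  obtain y where bdd: "bounded (range y)" and ev: "\<And>p. \<forall>\<^sub>F n in sequentially. code (y n) p = \<omega> p"
    and lim: "\<And>g :: 'a \<Rightarrow>\<^sub>L real. (\<lambda>n. g (y n)) \<longlonglongrightarrow> g x"
    using assms unfolding codes_limit_def by blast
  have "bounded (range (\<lambda>n. T (y n)))"
    using bounded_linear_image[OF bdd bounded_linear_T] by (simp add: image_image)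
  moreover have "\<forall>\<^sub>F n in sequentially. code (T (y n)) p = shift \<omega> p" for p
    using ev[of "(Suc (fst p), snd p)"] by eventually_elim (simp add: code_T shift_def split_beta)
  moreover have "(\<lambda>n. blinfun_apply g (T (y n))) \<longlonglongrightarrow> g (T x)" for g :: "'a \<Rightarrow>\<^sub>L real"
    using lim[of "g o\<^sub>L Blinfun T"] by (simp add: bounded_linear_Blinfun_apply[OF bounded_linear_T])
  ultimately show ?thesis unfolding codes_limit_def by blast
qed

text \<open>Together with the converse below, this turns the existence of a weak limit into a
  condition on countably many coordinates, hence a measurable one.\<close>

lemma codes_limit_in_good:
  assumes "codes_limit \<omega> x" shows "\<omega> \<in> realizable \<inter> bounded_codes"
proof -
  obtain y where bdd: "bounded (range y)" and ev: "\<And>p. \<forall>\<^sub>F n in sequentially. code (y n) p = \<omega> p"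
    using assms unfolding codes_limit_def by blast
  have "\<exists>y. \<forall>p\<in>J. code y p = \<omega> p" if "finite J" for J
  proof -
    have "\<forall>\<^sub>F n in sequentially. \<forall>p\<in>J. code (y n) p = \<omega> p"
      using that ev by (intro eventually_ball_finite) auto
    then show ?thesis using eventually_happens'[OF sequentially_bot] by blast
  qed
  moreover obtain r where r: "\<And>n. dist (d 0) (y n) \<le> r"
    using bdd unfolding bounded_any_center[of _ "d 0"] by auto
  obtain q where "r < real_of_rat q" using real_rat_between[of r "r + 1"] by auto
  then have t: "code (y n) (0, True, 0, q)" for n using r[of n] by (simp add: code_def test_set_def)
  have "\<forall>\<^sub>F n in sequentially. \<omega> (0, True, 0, q)"
    using ev[of "(0, True, 0, q)"] by eventually_elim (use t in simp)
  then have "\<omega> (0, True, 0, q)" by simp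
  ultimately show ?thesis by (auto simp: realizable_def bounded_codes_def)
qed

text \<open>Reflexivity replaces weak compactness of balls: points realizing longer and longer finite parts
  of \<open>\<omega>\<close> form a bounded sequence along which every norming functional converges.\<close>

lemma ex_codes_limit:
  assumes "\<omega> \<in> realizable \<inter> bounded_codes" shows "\<exists>x. codes_limit \<omega> x"
proof -
  obtain i q where iq: "\<omega> (0, True, i, q)" using assms by (auto simp: bounded_codes_def)
  \<comment> \<open>The ball bit belongs to every \<open>?J n\<close>, so all \<open>y n\<close> lie
    in one ball; the enumeration eventually brings in each coordinate.\<close>
  let ?J = "\<lambda>n. insert (0::nat, True, i, q) (from_nat ` {..<n})"
  have "finite (?J n)" for n by simp
  then have "\<forall>n. \<exists>y. \<forall>p\<in>?J n. code y p = \<omega> p" using assms unfolding realizable_def by blast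
  then obtain y where y: "\<And>n p. p \<in> ?J n \<Longrightarrow> code (y n) p = \<omega> p" by metis
  have ball: "y n \<in> cball (d i) (of_rat q)" for n
    using y[of "(0, True, i, q)" n] iq by (simp add: code_def test_set_def)
  then have bdd: "bounded (range y)" by (intro bounded_subset[OF bounded_cball]) auto
  then obtain r where r: "\<And>n. norm (y n) \<le> r" unfolding bounded_iff by auto
  have ev: "\<forall>\<^sub>F n in sequentially. code (y n) p = \<omega> p" for p
  proof (rule eventually_sequentiallyI)
    fix n assume "n \<ge> Suc (to_nat p)"
    then have "from_nat (to_nat p) \<in> ?J n" by (intro insertI2 imageI) simp
    then show "code (y n) p = \<omega> p" using y[of p n] by simp
  qed
  have conv: "convergent (\<lambda>n. f j (y n))" for j
  proof -
    have fr: "\<bar>f j (y n)\<bar> \<le> r" for n using abs_functional_le[of j "y n"] r[of n] by simp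
    \<comment> \<open>\<open>Q\<close> is the upper cut of the limit: it contains a rational iff the
      values are eventually at most that rational, so they tend to its infimum.\<close>
    define Q where "Q = {q. \<omega> (0, False, j, q)}"
    have evQ: "\<forall>\<^sub>F n in sequentially. (f j (y n) \<le> of_rat q) = (q \<in> Q)" for q
      using ev[of "(0, False, j, q)"] by eventually_elim (simp add: code_def test_set_def Q_def)
    obtain q1 where q1: "r < real_of_rat q1" using real_rat_between[of r "r + 1"] by auto
    have "\<forall>\<^sub>F n in sequentially. q1 \<in> Q"
      using evQ[of q1]
    proof eventually_elim
      case (elim n) then show ?case using fr[of n] q1 by linarith
    qed
    then have ne: "Q \<noteq> {}" by auto
    have lower: "- r \<le> of_rat q" if "q \<in> Q" for q
    proof -
      have "\<forall>\<^sub>F n in sequentially. - r \<le> of_rat q"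
        using evQ[of q]
      proof eventually_elim
        case (elim n) then show ?case using fr[of n] that by linarith
      qed
      then show ?thesis by simp
    qed
    then have bb: "bdd_below (real_of_rat ` Q)" by (intro bdd_belowI2) 
    have "(\<lambda>n. f j (y n)) \<longlonglongrightarrow> Inf (real_of_rat ` Q)"
    proof (rule order_tendstoI)
      fix a assume "a < Inf (real_of_rat ` Q)"
      then obtain q where q: "a < of_rat q" "of_rat q < Inf (real_of_rat ` Q)" using real_rat_between by blast
      then have "q \<notin> Q" using bb cInf_lower by (metis image_eqI not_less)
      with evQ[of q] show "\<forall>\<^sub>F n in sequentially. a < f j (y n)" using q(1) by (auto elim!: eventually_mono)
    next
      fix a assume "Inf (real_of_rat ` Q) < a"
      then obtain q where q: "q \<in> Q" "of_rat q < a" using ne bb by (auto simp: cInf_less_iff)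
      with evQ[of q] show "\<forall>\<^sub>F n in sequentially. f j (y n) < a" by (auto elim!: eventually_mono)
    qed
    then show ?thesis by (auto simp: convergent_def)
  qed
  from weakly_convergent[OF r conv] obtain x where "\<And>g :: 'a \<Rightarrow>\<^sub>L real. (\<lambda>n. g (y n)) \<longlonglongrightarrow> g x" by blast
  then show ?thesis using bdd ev unfolding codes_limit_def by blast
qed

lemma cylinder_coordinate: "{\<omega>. \<omega> p} \<in> cylinders"
  by (rule cylindersI[of "{p}"]) auto

lemma shift_vimage_cylinder:
  assumes "C \<in> cylinders" shows "shift -` C \<in> cylinders"
proof -
  obtain J where J: "finite J" "\<And>\<omega> \<omega>'. \<forall>j\<in>J. \<omega> j = \<omega>' j \<Longrightarrow> \<omega> \<in> C \<longleftrightarrow> \<omega>' \<in> C"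
    using cylindersE[OF assms] by metis
  show ?thesis
  proof (rule cylindersI[of "(\<lambda>(k, i). (Suc k, i)) ` J"])
    fix \<omega> \<omega>' :: "nat \<times> bool \<times> nat \<times> rat \<Rightarrow> bool"
    assume "\<forall>j\<in>(\<lambda>(k, i). (Suc k, i)) ` J. \<omega> j = \<omega>' j" and w: "\<omega> \<in> shift -` C"
    then have "\<forall>j\<in>J. shift \<omega> j = shift \<omega>' j" by (auto simp: shift_def)
    then show "\<omega>' \<in> shift -` C" using J(2)[of "shift \<omega>" "shift \<omega>'"] w by simp
  qed (use J in auto)
qed

lemma T_measurable [measurable]: "T \<in> measurable borel borel"
  by (rule borel_measurable_bounded_linear_self[OF bounded_linear_T])

section \<open>Pushing the limit measure forward to the space\<close>

theorem ex_invariant_full_support: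
  "\<exists>m. invariant_prob T m \<and> (\<forall>U. open U \<and> U \<noteq> {} \<longrightarrow> emeasure m U > 0)"
proof -
  define c where "c n = code ((T ^^ n) x0)" for n
  obtain r :: "nat \<Rightarrow> nat" and P where r: "strict_mono r" and P: "prob_space P"
    and sets_P: "sets P = sigma_sets UNIV cylinders"
    and lim: "\<And>C. C \<in> cylinders \<Longrightarrow> (\<lambda>k. freq c (r k) C) \<longlonglongrightarrow> measure P C"
    using ex_empirical_limit_measure[of c] by metis
  interpret P: prob_space P by (rule P)
  have space_P: "space P = UNIV"
    using sets_eq_imp_space_eq[of P "sigma UNIV cylinders"] sets_P by simp
  have cyl_sets: "C \<in> sets P" if "C \<in> cylinders" for C using that by (simp add: sets_P)
  have coord_sets[measurable]: "{\<omega>. \<omega> p} \<in> sets P" for p by (rule cyl_sets[OF cylinder_coordinate])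

  have shift_meas[measurable]: "shift \<in> measurable P P"
    by (rule measurable_sigma_sets[OF sets_P]) (use shift_vimage_cylinder cyl_sets in \<open>auto simp: space_P\<close>)
  have shift_inv: "distr P P shift = P"
  proof (rule measure_eqI_generator_eq[OF Int_stable_cylinders, where \<Omega> = UNIV and A = "\<lambda>_. UNIV"])
    fix C :: "(nat \<times> bool \<times> nat \<times> rat \<Rightarrow> bool) set" assume C: "C \<in> cylinders"
    have c_Suc: "freq c N (shift -` C) = freq (\<lambda>n. c (Suc n)) N C" for N
      by (simp add: freq_def c_def code_T)
    have "(\<lambda>k. freq (\<lambda>n. c (Suc n)) (r k) C - freq c (r k) C) \<longlonglongrightarrow> 0"
    proof (rule Lim_null_comparison)
      show "\<forall>\<^sub>F k in sequentially. norm (freq (\<lambda>n. c (Suc n)) (r k) C - freq c (r k) C) \<le> 1 / real (r k)"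
        using freq_shift_diff[of c] by simp
      show "(\<lambda>k. 1 / real (r k)) \<longlonglongrightarrow> 0"
        using LIMSEQ_subseq_LIMSEQ[OF lim_1_over_n r] by (simp add: o_def)
    qed
    moreover have "(\<lambda>k. freq (\<lambda>n. c (Suc n)) (r k) C - freq c (r k) C) \<longlonglongrightarrow> measure P (shift -` C) - measure P C"
      using tendsto_diff[OF lim[OF shift_vimage_cylinder[OF C]] lim[OF C]] by (simp add: c_Suc)
    ultimately have "measure P (shift -` C) = measure P C" using LIMSEQ_unique by fastforce
    then show "emeasure (distr P P shift) C = emeasure P C"
      by (simp add: emeasure_distr cyl_sets[OF C] space_P P.emeasure_eq_measure)
  qed (use P.emeasure_space_1 in \<open>auto simp: sets_P shift_meas emeasure_distr space_P\<close>)

  define G where "G = realizable \<inter> bounded_codes"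
  have AE_real: "AE \<omega> in P. \<omega> \<in> realizable" and real_sets: "realizable \<in> sets P"
  proof -
    let ?F = "{J :: (nat \<times> bool \<times> nat \<times> rat) set. finite J}"
    define B where "B J = {\<omega>. \<not> (\<exists>y. \<forall>p\<in>J. code y p = \<omega> p)}" for J
    have B: "B J \<in> cylinders" if "finite J" for J
    proof (rule cylindersI[OF that])
      fix \<omega> \<omega>' :: "nat \<times> bool \<times> nat \<times> rat \<Rightarrow> bool"
      assume eq: "\<forall>p\<in>J. \<omega> p = \<omega>' p" and w: "\<omega> \<in> B J"
      have "\<forall>p\<in>J. code y p = \<omega> p" if "\<forall>p\<in>J. code y p = \<omega>' p" for y using that eq by metis
      then show "\<omega>' \<in> B J" using w unfolding B_def by blast
    qed
    \<comment> \<open>\<open>B J\<close> collects the patterns on \<open>J\<close> that no point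
      has, so the orbit codes never visit it and its limit frequency is zero.\<close>
    have "B J \<in> null_sets P" if "finite J" for J
    proof -
      have "freq c N (B J) = 0" for N by (auto simp: freq_def B_def c_def)
      then have "measure P (B J) = 0" using LIMSEQ_unique[OF lim[OF B[OF that]], of 0] by simp
      then show ?thesis using cyl_sets[OF B[OF that]] by (simp add: null_sets_def P.emeasure_eq_measure)
    qed
    then have "(\<Union>J\<in>?F. B J) \<in> null_sets P"
      by (intro null_sets_UN' countable_Collect_finite) auto
    moreover have eq: "realizable = UNIV - (\<Union>J\<in>?F. B J)" unfolding realizable_def B_def by blast
    ultimately show "AE \<omega> in P. \<omega> \<in> realizable" by (auto dest: AE_not_in)
    show "realizable \<in> sets P"
      unfolding eq using \<open>(\<Union>J\<in>?F. B J) \<in> null_sets P\<close> sets.Diff[OF sets.top, of _ P] by (simp add: space_P null_sets_def)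
  qed
  have "bounded_codes = (\<Union>i. \<Union>q. {\<omega>. \<omega> (0, True, i, q)})" by (auto simp: bounded_codes_def)
  also have "\<dots> \<in> sets P" by (intro sets.countable_UN'' coord_sets) auto
  finally have bdd_sets: "bounded_codes \<in> sets P" .
  have G_sets[measurable]: "G \<in> sets P" unfolding G_def using real_sets bdd_sets by simp
  have G_iff: "\<omega> \<in> G \<longleftrightarrow> (\<exists>x. codes_limit \<omega> x)" for \<omega>
    using codes_limit_in_good ex_codes_limit unfolding G_def by blast
  \<comment> \<open>A constant value off \<open>G\<close> keeps \<open>st\<close> measurable; the
    measure is later conditioned on \<open>G\<close>.\<close>
  define st where "st \<omega> = (if \<omega> \<in> G then THE x. codes_limit \<omega> x else 0)" for \<omega>
  have st: "codes_limit \<omega> (st \<omega>)" if "\<omega> \<in> G" for \<omega>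
  proof -
    have "\<exists>!x. codes_limit \<omega> x" using that G_iff codes_limit_unique by blast
    then show ?thesis using theI'[of "codes_limit \<omega>"] that by (simp add: st_def)
  qed
  have shift_G: "shift \<omega> \<in> G" and st_shift: "st (shift \<omega>) = T (st \<omega>)" if "\<omega> \<in> G" for \<omega>
  proof -
    have *: "codes_limit (shift \<omega>) (T (st \<omega>))" by (rule codes_limit_shift[OF st[OF that]])
    then show "shift \<omega> \<in> G" using G_iff by blast
    then show "st (shift \<omega>) = T (st \<omega>)" using codes_limit_unique[OF st *] by simp
  qed
  have st_meas: "st \<in> measurable P borel"
  proof (rule measurable_functionals)
    fix j
    show "(\<lambda>\<omega>. f j (st \<omega>)) \<in> borel_measurable P"
      unfolding borel_measurable_iff_less
    proof
      fix a
      \<comment> \<open>The bits decide \<open>f j (st \<omega>)\<close> only up to equality, which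
        is harmless for a strict inequality: a rational fits between.\<close>
      have *: "f j (st \<omega>) < a \<longleftrightarrow> (\<exists>q. of_rat q < a \<and> \<omega> (0, False, j, q))" if "\<omega> \<in> G" for \<omega>
      proof
        assume "f j (st \<omega>) < a"
        then obtain q where "f j (st \<omega>) < of_rat q" "of_rat q < a" using real_rat_between by blast
        then show "\<exists>q. of_rat q < a \<and> \<omega> (0, False, j, q)" using codes_limitD(3)[OF st[OF that], of j q] by force
      next
        assume "\<exists>q. of_rat q < a \<and> \<omega> (0, False, j, q)"
        then show "f j (st \<omega>) < a" using codes_limitD(2)[OF st[OF that], of j] by force
      qed
      have "{\<omega> \<in> space P. f j (st \<omega>) < a} =
          (G \<inter> (\<Union>q\<in>{q. real_of_rat q < a}. {\<omega>. \<omega> (0, False, j, q)})) \<union> (if 0 < a then UNIV - G else {})"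
        using * by (auto simp: space_P st_def[of "_ :: nat \<times> bool \<times> nat \<times> rat \<Rightarrow> bool"])
      also have "\<dots> \<in> sets P"
        using sets.compl_sets[OF G_sets] by (auto simp: space_P intro!: sets.Un sets.Int G_sets sets.countable_UN' countableI_type)
      finally show "{\<omega> \<in> space P. f j (st \<omega>) < a} \<in> sets P" .
    qed
  qed

  \<comment> \<open>A true ball bit puts a code in \<open>bounded_codes\<close>, so up to a null set
    its cylinder lies in \<open>G\<close>. The measure of this cylinder is a limit of visit
    frequencies of a closed ball, which dominate those of the open ball.\<close>
  have pos: "\<exists>C\<in>sets P. emeasure P (G \<inter> C) > 0 \<and> (\<forall>\<omega>\<in>G \<inter> C. st \<omega> \<in> U)" if U: "open U" "U \<noteq> {}" for U
  proof -
    obtain i q' where q': "q' \<in> \<rat>" "q' > 0" "cball (d i) q' \<subseteq> U"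
      using open_contains_cball_dense[OF U(1)] U(2) by (metis equals0I)
    then obtain q where q: "q' = of_rat q" by (auto simp: Rats_def)
    let ?C = "{\<omega>. \<omega> (0, True, i, q)}"
    obtain e where e: "e > 0" "\<forall>\<^sub>F N in sequentially. e \<le> freq (\<lambda>n. (T ^^ n) x0) N (ball (d i) q')"
      using freq_pos[of "ball (d i) q'"] q' by auto
    have le: "freq (\<lambda>n. (T ^^ n) x0) N (ball (d i) q') \<le> freq c N ?C" for N
      unfolding freq_def c_def code_def test_set_def q
      by (intro divide_right_mono of_nat_mono card_mono) auto
    have "\<forall>\<^sub>F k in sequentially. e \<le> freq c (r k) ?C"
      using eventually_subseq[OF r e(2)] by eventually_elim (use le order_trans in blast)
    then have "e \<le> measure P ?C"
      by (intro tendsto_lowerbound[OF lim[OF cylinder_coordinate]]) auto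
    then have "emeasure P ?C > 0" using e(1) by (simp add: P.emeasure_eq_measure)
    also have "emeasure P ?C = emeasure P (G \<inter> ?C)"
    proof (rule emeasure_eq_AE)
      show "AE \<omega> in P. \<omega> \<in> ?C \<longleftrightarrow> \<omega> \<in> G \<inter> ?C"
        using AE_real by eventually_elim (auto simp: G_def bounded_codes_def)
    qed auto
    finally have "emeasure P (G \<inter> ?C) > 0" .
    moreover have "st \<omega> \<in> U" if "\<omega> \<in> G \<inter> ?C" for \<omega>
      using codes_limitD(1)[OF st, of \<omega> i q] that q'(3) q by auto
    ultimately show ?thesis using coord_sets by blast
  qed
  \<comment> \<open>The case \<open>U = UNIV\<close> shows that \<open>G\<close> has positive
    measure, so conditioning on it is legitimate.\<close>
  obtain C where "C \<in> sets P" "emeasure P (G \<inter> C) > 0" using pos[of UNIV] by auto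
  then have G_pos: "emeasure P G > 0"
    using emeasure_mono[of "G \<inter> C" G P] by (auto intro: less_le_trans)
  let ?Q = "uniform_measure P G"
  interpret Q: prob_space ?Q
    using G_pos by (intro prob_space_uniform_measure) (auto simp: P.emeasure_eq_measure)
  have st_Q: "st \<in> measurable ?Q borel" using st_meas by (simp cong: measurable_cong_sets)
  define m where "m = distr ?Q borel st"
  have m: "emeasure m A = emeasure ?Q (st -` A)" if "A \<in> sets borel" for A
    using that unfolding m_def by (simp add: emeasure_distr[OF st_Q] space_P)
  have st_sets: "st -` A \<in> sets P" if "A \<in> sets borel" for A
    using measurable_sets[OF st_meas that] by (simp add: space_P)
  have prob: "prob_space m" unfolding m_def by (rule Q.prob_space_distr[OF st_Q])
  have "distr m borel T = m"
  proof (rule measure_eqI)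
    fix A assume "A \<in> sets (distr m borel T)"
    then have A[measurable]: "A \<in> sets borel" by simp
    have TA: "T -` A \<in> sets borel" using measurable_sets[OF T_measurable A] by simp
    have "emeasure (distr m borel T) A = emeasure m (T -` A)"
      by (subst emeasure_distr) (auto simp: m_def)
    also have "\<dots> = emeasure P (G \<inter> st -` (T -` A)) / emeasure P G"
      using m[OF TA] st_sets[OF TA] by simp
    \<comment> \<open>On \<open>G\<close> the map \<open>st\<close> intertwines \<open>shift\<close>
      with \<open>T\<close>, so invariance of the conditioned measure passes to
      \<open>m\<close>.\<close>
    also have "G \<inter> st -` (T -` A) = G \<inter> (shift -` (st -` A))"
      using st_shift by auto
    also have "emeasure P (G \<inter> (shift -` (st -` A))) / emeasure P G = emeasure ?Q (shift -` (st -` A) \<inter> space P)"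
      using measurable_sets[OF shift_meas st_sets[OF A]] by (simp add: space_P)
    also have "\<dots> = emeasure ?Q (st -` A)"
      by (rule emeasure_uniform_measure_invariant[OF shift_meas shift_inv G_sets _ st_sets[OF A]])
        (rule AE_invariant_subset[OF P shift_meas shift_inv G_sets shift_G])
    also have "\<dots> = emeasure m A" by (simp add: m)
    finally show "emeasure (distr m borel T) A = emeasure m A" .
  qed (simp add: m_def)
  moreover have "emeasure m U > 0" if U: "open U" "U \<noteq> {}" for U
  proof -
    obtain C where C: "C \<in> sets P" "emeasure P (G \<inter> C) > 0" "\<forall>\<omega>\<in>G \<inter> C. st \<omega> \<in> U" using pos[OF U] by blast
    have U': "U \<in> sets borel" using U by simp
    have "0 < emeasure P (G \<inter> C) / emeasure P G"
      using C(2) by (simp add: ennreal_zero_less_divide P.emeasure_eq_measure)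
    also have "\<dots> \<le> emeasure P (G \<inter> st -` U) / emeasure P G"
      using C by (intro divide_right_mono_ennreal emeasure_mono) (auto intro: st_sets[OF U'])
    also have "\<dots> = emeasure m U" using m[OF U'] st_sets[OF U'] by simp
    finally show ?thesis .
  qed
  ultimately show ?thesis unfolding invariant_prob_def using prob by (intro exI[of _ m]) (auto simp: m_def)
qed

end

section \<open>Avoiding the periodic points\<close>

lemma invariant_prob_distr_self:
  assumes "invariant_prob T m" shows "distr m m T = m"
  using assms unfolding invariant_prob_def by (metis distr_cong)

lemma distr_pair_invariant:
  assumes "prob_space M" "prob_space N" "f \<in> measurable M M" "g \<in> measurable N N"
    "distr M M f = M" "distr N N g = N"
  shows "distr (M \<Otimes>\<^sub>M N) (M \<Otimes>\<^sub>M N) (\<lambda>(x, y). (f x, g y)) = M \<Otimes>\<^sub>M N"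
  using pair_measure_distr[of f M M g N N] assms by (simp add: prob_space_imp_sigma_finite)

abbreviation unit_interval_measure :: "real measure" where
  "unit_interval_measure \<equiv> restrict_space lborel {0..1}"

lemma prob_space_unit_interval: "prob_space unit_interval_measure"
  by (rule prob_spaceI) (simp add: emeasure_restrict_space space_restrict_space)

lemma AE_unit_interval_unique:
  assumes "\<And>s t. P s \<Longrightarrow> P t \<Longrightarrow> s = t"
  shows "AE t in unit_interval_measure. \<not> P t"
proof (cases "\<exists>s. P s")
  case True
  then obtain s where s: "P s" by blast
  have "AE t in lborel. t \<noteq> s" by (rule AE_lborel_singleton)
  then have "AE t in unit_interval_measure. t \<noteq> s"
    by (auto simp: AE_restrict_space_iff elim: eventually_mono)
  then show ?thesis by eventually_elim (use assms s in blast)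
qed simp

lemma measurable_PiM_componentwise:
  assumes \<Theta>: "\<Theta> \<in> measurable S S"
  shows "(\<lambda>\<omega> k. \<Theta> (\<omega> k)) \<in> measurable (PiM (UNIV :: nat set) (\<lambda>_. S)) (PiM UNIV (\<lambda>_. S))"
  using measurable_space[OF \<Theta>] \<Theta> by (intro measurable_PiM_single') (auto simp: space_PiM)

text \<open>Invariance is tested on boxes with finitely many constrained coordinates, whose
  preimages are boxes of the same kind.\<close>

lemma distr_PiM_invariant:
  assumes S: "prob_space S" and \<Theta>[measurable]: "\<Theta> \<in> measurable S S" and inv: "distr S S \<Theta> = S"
  shows "distr (PiM (UNIV :: nat set) (\<lambda>_. S)) (PiM UNIV (\<lambda>_. S)) (\<lambda>\<omega> k. \<Theta> (\<omega> k)) = PiM UNIV (\<lambda>_. S)"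
proof -
  interpret S: prob_space S by fact
  interpret sequence_space S by unfold_locales
  let ?P = "PiM (UNIV :: nat set) (\<lambda>_. S)" and ?h = "\<lambda>\<omega> k :: nat. \<Theta> (\<omega> k)"
  have h: "?h \<in> measurable ?P ?P" by (rule measurable_PiM_componentwise[OF \<Theta>])
  show ?thesis
  proof (rule PiM_eq)
    fix J :: "nat set" and F assume J: "finite J" "J \<subseteq> UNIV" and F: "\<And>j. j \<in> J \<Longrightarrow> F j \<in> sets S"
    let ?F = "\<lambda>j. \<Theta> -` F j \<inter> space S"
    have F': "j \<in> J \<Longrightarrow> ?F j \<in> sets S" for j using F by measurable
    have "?h -` prod_emb UNIV (\<lambda>_. S) J (Pi\<^sub>E J F) \<inter> space ?P = prod_emb UNIV (\<lambda>_. S) J (Pi\<^sub>E J ?F)"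
      using measurable_space[OF \<Theta>] by (auto simp: prod_emb_def space_PiM PiE_iff)
    then have "emeasure (distr ?P ?P ?h) (prod_emb UNIV (\<lambda>_. S) J (Pi\<^sub>E J F)) = emeasure ?P (prod_emb UNIV (\<lambda>_. S) J (Pi\<^sub>E J ?F))"
      using J F by (subst emeasure_distr[OF h]) (auto intro!: sets_PiM_I)
    also have "\<dots> = (\<Prod>j\<in>J. emeasure S (?F j))" using J F' by (intro emeasure_PiM_emb) auto
    also have "\<dots> = (\<Prod>j\<in>J. emeasure (distr S S \<Theta>) (F j))" using F by (intro prod.cong) (auto simp: emeasure_distr)
    finally show "emeasure (distr ?P ?P ?h) (prod_emb UNIV (\<lambda>_. S) J (Pi\<^sub>E J F)) = (\<Prod>j\<in>J. emeasure S (F j))"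
      by (simp add: inv)
  qed simp
qed

section \<open>Periodic points of a linear operator\<close>

lemma subspace_funpow_fixed:
  assumes "linear T" shows "subspace {x. (T ^^ N) x = x}"
proof -
  have "linear (T ^^ N)"
  proof (induction N)
    case (Suc N) then show ?case using linear_compose[OF Suc assms] by (simp add: o_def)
  qed (simp add: linear_id[unfolded id_def])
  then show ?thesis by (auto simp: subspace_def linear_add linear_cmul linear_0)
qed

text \<open>Points fixed by \<open>T ^^ N\<close> and by \<open>T ^^ M\<close> are both fixed by
  \<open>T ^^ (N * M)\<close>, which reduces sums to a single subspace.\<close>

lemma subspace_Per:
  assumes "linear T" shows "subspace (Per T)"
proof -
  have mult: "(T ^^ (N * k)) x = x" if "(T ^^ N) x = x" for N k x
    using funpow_mod_eq[OF that, of "N * k"] by simp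
  note sub = subspace_funpow_fixed[OF assms]
  show ?thesis
    unfolding subspace_def
  proof (intro conjI ballI allI)
    show "0 \<in> Per T" using subspace_0[OF sub[of 1]] by (auto simp: Per_def)
  next
    fix x y assume "x \<in> Per T" "y \<in> Per T"
    then obtain N M where N: "N \<ge> 1" "(T ^^ N) x = x" and M: "M \<ge> 1" "(T ^^ M) y = y" by (auto simp: Per_def)
    have "(T ^^ (N * M)) (x + y) = x + y"
      using subspace_add[OF sub[of "N * M"], of x y] mult[OF N(2), of M] mult[OF M(2), of N] by (simp add: mult.commute)
    then show "x + y \<in> Per T" using N M by (auto simp: Per_def intro!: exI[of _ "N * M"])
  next
    fix c x assume "x \<in> Per T"
    then show "c *\<^sub>R x \<in> Per T" using subspace_scale[OF sub] by (fastforce simp: Per_def)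
  qed
qed

text \<open>The two points differ by \<open>(s - t) *\<^sub>R z\<close>; if
  \<open>s \<noteq> t\<close>, rescaling puts \<open>z\<close> in \<open>S\<close>.\<close>

lemma subspace_line_unique:
  assumes S: "subspace S" and "z \<notin> S" "x + s *\<^sub>R z \<in> S" "x + t *\<^sub>R z \<in> S"
  shows "s = (t::real)"
proof (rule ccontr)
  assume "s \<noteq> t"
  have "(x + s *\<^sub>R z) - (x + t *\<^sub>R z) \<in> S" using assms by (intro subspace_diff)
  then have "(1 / (s - t)) *\<^sub>R ((x + s *\<^sub>R z) - (x + t *\<^sub>R z)) \<in> S" by (rule subspace_scale[OF S])
  also have "(1 / (s - t)) *\<^sub>R ((x + s *\<^sub>R z) - (x + t *\<^sub>R z)) = z"
    using \<open>s \<noteq> t\<close> by (simp flip: scaleR_diff_left)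
  finally show False using assms by simp
qed

lemma Per_eq_Union: "Per T = (\<Union>N\<in>{1..}. {x. (T ^^ N) x = x})"
  by (auto simp: Per_def)

lemma T_in_Per: "x \<in> Per T \<Longrightarrow> T x \<in> Per T"
  unfolding Per_def by (auto simp flip: funpow_swap1)

lemma continuous_on_funpow:
  fixes T :: "'a::topological_space \<Rightarrow> 'a"
  assumes "continuous_on UNIV T" shows "continuous_on UNIV (T ^^ N)"
proof (induction N)
  case (Suc N)
  have "continuous_on (range (T ^^ N)) T" by (rule continuous_on_subset[OF assms]) simp
  from continuous_on_compose[OF Suc this] show ?case by (simp add: o_def)
qed (simp add: id_def)

context
  fixes T :: "'a::banach \<Rightarrow> 'a"
  assumes T: "bounded_linear T"
begin

lemma continuous_T_funpow: "continuous_on UNIV (T ^^ N)"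
  by (rule continuous_on_funpow[OF linear_continuous_on[OF T]])

lemma closed_funpow_fixed: "closed {x. (T ^^ N) x = x}"
  by (rule closed_Collect_eq[OF continuous_T_funpow continuous_on_id])

lemma funpow_fixed_sets: "{x. (T ^^ N) x = x} \<in> sets borel"
  using closed_funpow_fixed by simp

lemma Per_sets: "Per T \<in> sets borel"
  unfolding Per_eq_Union by (intro sets.countable_UN'' funpow_fixed_sets) auto

text \<open>A non-periodic point may be mapped to a periodic one, so the complement of
  \<open>Per T\<close> need not be mapped into itself. But \<open>Per T\<close> is, and this makes
  both sets invariant up to a null set.\<close>

lemma invariant_prob_off_Per:
  assumes inv: "invariant_prob T m" and lt: "emeasure m (Per T) \<noteq> 1"
  shows "\<exists>n. invariant_prob T n \<and> emeasure n (Per T) = 0"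
proof -
  interpret m: prob_space m using inv by (simp add: invariant_prob_def)
  have sets_m: "sets m = sets borel" using inv by (simp add: invariant_prob_def)
  have space_m: "space m = UNIV" using sets_eq_imp_space_eq[OF sets_m] by simp
  have P: "Per T \<in> sets m" using Per_sets sets_m by simp
  have Tm: "T \<in> measurable m m" using borel_measurable_bounded_linear_self[OF T] by (simp add: measurable_cong_sets[OF sets_m sets_m])
  let ?G = "UNIV - Per T"
  have G: "?G \<in> sets m" using sets.compl_sets[OF P] by (simp add: space_m)
  have "AE x in m. T x \<in> Per T \<longleftrightarrow> x \<in> Per T"
    by (rule AE_invariant_subset[OF m.prob_space_axioms Tm invariant_prob_distr_self[OF inv] P T_in_Per])
  then have ae: "AE x in m. T x \<in> ?G \<longleftrightarrow> x \<in> ?G" by eventually_elim auto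
  have G_ne: "emeasure m ?G \<noteq> 0"
  proof
    assume "emeasure m ?G = 0"
    then have "AE x in m. x \<in> Per T" using G by (intro AE_I[where N = ?G]) (auto simp: space_m)
    then show False using lt m.emeasure_eq_1_AE[OF P] by simp
  qed
  let ?n = "uniform_measure m ?G"
  have "prob_space ?n" using G_ne by (intro prob_space_uniform_measure) (auto simp: m.emeasure_eq_measure)
  moreover have "distr ?n borel T = ?n"
  proof (rule measure_eqI)
    fix A assume "A \<in> sets (distr ?n borel T)"
    then have A: "A \<in> sets m" by (simp add: sets_m)
    have "emeasure (distr ?n borel T) A = emeasure ?n (T -` A \<inter> space m)"
      using A borel_measurable_bounded_linear_self[OF T] by (subst emeasure_distr) (auto simp: sets_m measurable_def space_m)
    also have "\<dots> = emeasure ?n A"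
      by (rule emeasure_uniform_measure_invariant[OF Tm invariant_prob_distr_self[OF inv] G ae A])
    finally show "emeasure (distr ?n borel T) A = emeasure ?n A" .
  qed (simp add: sets_m)
  moreover have "emeasure ?n (Per T) = 0" using G P by (simp add: Diff_Int_distrib2)
  ultimately show ?thesis unfolding invariant_prob_def using sets_m by (intro exI[of _ ?n]) auto
qed

end

section \<open>Laws of random sums\<close>

context separable_reflexive
begin

lemma borel_functional [measurable]: "blinfun_apply (f j) \<in> borel_measurable borel"
  by (rule borel_measurable_continuous_onI) (intro continuous_intros)

text \<open>Applying each \<open>f j\<close> turns the vector operations into real ones.\<close>

lemma measurable_add_scaleR [measurable (raw)]:
  fixes g h :: "'b \<Rightarrow> 'a"
  assumes [measurable]: "g \<in> measurable M borel" "h \<in> measurable M borel" "a \<in> borel_measurable M"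
  shows "(\<lambda>\<omega>. g \<omega> + a \<omega> *\<^sub>R h \<omega>) \<in> measurable M borel"
  by (rule measurable_functionals) (simp add: blinfun.add_right blinfun.scaleR_right)

lemma measurable_scaleR_real [measurable (raw)]:
  fixes h :: "'b \<Rightarrow> 'a"
  assumes [measurable]: "h \<in> measurable M borel" "a \<in> borel_measurable M"
  shows "(\<lambda>\<omega>. a \<omega> *\<^sub>R h \<omega>) \<in> measurable M borel"
  by (rule measurable_functionals) (simp add: blinfun.scaleR_right)

text \<open>The measure is the law of the random series \<open>Z = \<Sum>k. 2\<^sup>-\<^sup>k g(s\<^sub>k)\<close> with independent \<open>s\<^sub>k\<close>;
  splitting off the first term exhibits \<open>Z\<close> as \<open>g(s) + Z/2\<close> in law.\<close>

lemma ex_self_similar_invariant: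
  fixes T :: "'a \<Rightarrow> 'a" and g :: "'s \<Rightarrow> 'a"
  assumes T: "bounded_linear T" and S: "prob_space S"
    and g[measurable]: "g \<in> measurable S borel" and g_le: "\<And>s. s \<in> space S \<Longrightarrow> norm (g s) \<le> 1"
    and \<Theta>[measurable]: "\<Theta> \<in> measurable S S" and inv: "distr S S \<Theta> = S"
    and g_\<Theta>: "\<And>s. s \<in> space S \<Longrightarrow> g (\<Theta> s) = T (g s)"
  shows "\<exists>n. invariant_prob T n \<and> distr (S \<Otimes>\<^sub>M n) borel (\<lambda>(s, z). g s + (1/2) *\<^sub>R z) = n"
proof -
  interpret S: prob_space S by fact
  interpret sequence_space S by unfold_locales
  let ?P = "PiM (UNIV :: nat set) (\<lambda>_. S)"
  have in_S: "\<omega> k \<in> space S" if "\<omega> \<in> space ?P" for \<omega> k using that by (auto simp: space_PiM)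
  define Z where "Z \<omega> = (\<Sum>k. (1/2)^k *\<^sub>R g (\<omega> k))" for \<omega>
  have summ: "summable (\<lambda>k. (1/2)^k *\<^sub>R g (\<omega> k))" if "\<omega> \<in> space ?P" for \<omega>
  proof (rule summable_comparison_test')
    show "summable (\<lambda>k. (1/2 :: real)^k)" by (intro summable_geometric) simp
    show "norm ((1/2)^k *\<^sub>R g (\<omega> k)) \<le> (1/2)^k" for k
      using g_le[OF in_S[OF that], of k] by (simp add: power_divide divide_right_mono)
  qed
  have Z_meas[measurable]: "Z \<in> measurable ?P borel"
  proof (rule measurable_functionals)
    fix j
    have eq: "f j (Z \<omega>) = (\<Sum>k. (1/2)^k * f j (g (\<omega> k)))" if "\<omega> \<in> space ?P" for \<omega>
      unfolding Z_def
      by (simp add: bounded_linear.suminf[OF blinfun.bounded_linear_right summ[OF that]] blinfun.scaleR_right)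
    show "(\<lambda>\<omega>. f j (Z \<omega>)) \<in> borel_measurable ?P"
      by (subst measurable_cong[OF eq]) measurable
  qed
  define n where "n = distr ?P borel Z"
  interpret n: prob_space n unfolding n_def by (rule P.prob_space_distr) simp
  \<comment> \<open>\<open>T\<close> passes through the series term by term, where it acts on each
    sample as \<open>\<Theta>\<close>.\<close>
  have TZ: "T (Z \<omega>) = Z (\<lambda>k. \<Theta> (\<omega> k))" if "\<omega> \<in> space ?P" for \<omega>
    unfolding Z_def
    by (simp add: bounded_linear.suminf[OF T summ[OF that]] linear_cmul[OF bounded_linear.linear[OF T]] g_\<Theta>[OF in_S[OF that]])
  have "distr n borel T = distr ?P borel (\<lambda>\<omega>. T (Z \<omega>))"
    unfolding n_def by (subst distr_distr[OF borel_measurable_bounded_linear_self[OF T] Z_meas]) (simp add: o_def)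
  also have "\<dots> = distr ?P borel (\<lambda>\<omega>. Z (\<lambda>k. \<Theta> (\<omega> k)))" by (intro distr_cong) (auto simp: TZ)
  also have "\<dots> = distr (distr ?P ?P (\<lambda>\<omega> k. \<Theta> (\<omega> k))) borel Z"
    by (subst distr_distr[OF Z_meas measurable_PiM_componentwise[OF \<Theta>]]) (simp add: o_def)
  also have "\<dots> = n" by (simp add: distr_PiM_invariant[OF S \<Theta> inv] n_def)
  finally have "invariant_prob T n" using n.prob_space_axioms by (simp add: invariant_prob_def) (simp add: n_def)
  moreover have "distr (S \<Otimes>\<^sub>M n) borel (\<lambda>(s, z). g s + (1/2) *\<^sub>R z) = n"
  proof -
    have Z_iter: "Z (case_nat s \<omega>) = g s + (1/2) *\<^sub>R Z \<omega>" if "s \<in> space S" "\<omega> \<in> space ?P" for s \<omega>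
    proof -
      have "case_nat s \<omega> \<in> space ?P" using that by (auto simp: space_PiM PiE_iff split: nat.split)
      then have "Z (case_nat s \<omega>) = (\<Sum>k. (1/2)^Suc k *\<^sub>R g (\<omega> k)) + g s"
        unfolding Z_def using suminf_split_head[OF summ, of "case_nat s \<omega>"] by simp
      also have "(\<Sum>k. (1/2)^Suc k *\<^sub>R g (\<omega> k)) = (1/2) *\<^sub>R Z \<omega>"
        unfolding Z_def using suminf_scaleR_right[OF summ[OF that(2)], of "1/2"] by simp
      finally show ?thesis by simp
    qed
    \<comment> \<open>Passing to \<open>?P\<close> exposes the sequence itself: prepending an
      independent sample to it reproduces \<open>?P\<close>.\<close>
    have "S \<Otimes>\<^sub>M n = distr S S (\<lambda>x. x) \<Otimes>\<^sub>M distr ?P borel Z" by (simp add: n_def)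
    also have "\<dots> = distr (S \<Otimes>\<^sub>M ?P) (S \<Otimes>\<^sub>M borel) (\<lambda>(s, \<omega>). (s, Z \<omega>))"
      by (rule pair_measure_distr) (auto simp flip: n_def simp: prob_space_imp_sigma_finite n.prob_space_axioms)
    finally have "distr (S \<Otimes>\<^sub>M n) borel (\<lambda>(s, z). g s + (1/2) *\<^sub>R z)
        = distr (S \<Otimes>\<^sub>M ?P) borel (\<lambda>(s, \<omega>). g s + (1/2) *\<^sub>R Z \<omega>)"
      by (simp add: distr_distr o_def split_beta')
    also have "\<dots> = distr (S \<Otimes>\<^sub>M ?P) borel (Z \<circ> (\<lambda>(s, \<omega>). case_nat s \<omega>))"
      by (intro distr_cong) (auto simp: Z_iter space_pair_measure)
    also have "\<dots> = distr (distr (S \<Otimes>\<^sub>M ?P) ?P (\<lambda>(s, \<omega>). case_nat s \<omega>)) borel Z"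
      by (subst distr_distr[OF Z_meas]) auto
    also have "\<dots> = n" by (simp add: PiM_iter n_def)
    finally show ?thesis .
  qed
  ultimately show ?thesis by blast
qed

text \<open>On periodic points \<open>h x = sup\<^sub>k \<parallel>T\<^sup>k x\<parallel>\<close> is finite and \<open>T\<close>-invariant, so \<open>x / h x\<close> has a bounded
  invariant law. For \<open>Z\<close> equal in law to \<open>t x / h x + Z/2\<close>, with \<open>t\<close> uniform, and \<open>W = ker (T\<^sup>N - I)\<close>, almost
  surely the sum lies in \<open>W\<close> only if both \<open>x\<close> and \<open>Z\<close> do. Hence
  \<open>P(Z \<in> W) \<le> m(W) P(Z \<in> W)\<close>, which forces \<open>P(Z \<in> W) = 0\<close>.\<close>

lemma ex_invariant_null_Per_if_Per_full:
  fixes T :: "'a \<Rightarrow> 'a"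
  assumes T: "bounded_linear T" and inv: "invariant_prob T m" and full: "emeasure m (Per T) = 1"
    and lt: "\<And>N. N \<ge> 1 \<Longrightarrow> emeasure m {x. (T ^^ N) x = x} < 1"
  shows "\<exists>n. invariant_prob T n \<and> emeasure n (Per T) = 0"
proof -
  interpret m: prob_space m using inv by (simp add: invariant_prob_def)
  have sets_m[measurable_cong]: "sets m = sets borel" using inv by (simp add: invariant_prob_def)
  have space_m: "space m = UNIV" using sets_eq_imp_space_eq[OF sets_m] by simp
  have P[measurable]: "Per T \<in> sets m" using Per_sets[OF T] sets_m by simp
  have T_borel[measurable]: "T \<in> measurable borel borel" by (rule borel_measurable_bounded_linear_self[OF T])
  have Tm[measurable]: "T \<in> measurable m m" using T_borel by (simp add: measurable_cong_sets[OF sets_m sets_m])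
  have linT: "linear T" by (rule bounded_linear.linear[OF T])
  have AE_P: "AE x in m. x \<in> Per T" using full m.AE_in_set_eq_1[OF P] by (simp add: m.emeasure_eq_measure)

  \<comment> \<open>Orbits are finite on \<open>Per T\<close>, so there the supremum
    \<open>h\<close> is over a bounded set; samples are therefore drawn from \<open>Per T\<close>
    itself.\<close>
  let ?m = "restrict_space m (Per T)" and ?U = unit_interval_measure
  interpret U: prob_space ?U by (rule prob_space_unit_interval)
  have space_m': "space ?m = Per T" by (simp add: space_restrict_space space_m)
  interpret m': prob_space ?m
    by (rule prob_spaceI) (simp add: emeasure_restrict_space space_m' P full space_m)
  have T_m'[measurable]: "T \<in> measurable ?m ?m"
    by (rule measurable_restrict_space3[OF Tm]) (auto intro: T_in_Per)
  have inv_m': "distr ?m ?m T = ?m"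
  proof (rule measure_eqI)
    fix A assume "A \<in> sets (distr ?m ?m T)"
    then have A': "A \<in> sets ?m" by simp
    then have A: "A \<in> sets m" "A \<subseteq> Per T" using P by (auto simp: sets_restrict_space_iff space_m)
    have "emeasure (distr ?m ?m T) A = emeasure m (T -` A \<inter> Per T)"
      using A' by (subst emeasure_distr[OF T_m']) (auto simp: space_m' emeasure_restrict_space space_m P)
    also have "\<dots> = emeasure m (T -` A \<inter> space m)"
      by (rule emeasure_eq_AE) (use AE_P A in \<open>auto simp: space_m intro: measurable_sets[OF Tm, of A, unfolded space_m, simplified]\<close>)
    also have "\<dots> = emeasure (distr m m T) A" using A by (simp add: emeasure_distr)
    also have "\<dots> = emeasure ?m A" using A by (simp add: invariant_prob_distr_self[OF inv] emeasure_restrict_space space_m P)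
    finally show "emeasure (distr ?m ?m T) A = emeasure ?m A" .
  qed simp

  define h where "h x = (SUP k. norm ((T ^^ k) x))" for x
  have fin: "finite (range (\<lambda>k. (T ^^ k) x))" if x: "x \<in> Per T" for x
  proof -
    obtain N where N: "N \<ge> 1" "(T ^^ N) x = x" using x by (auto simp: Per_def)
    have "range (\<lambda>k. (T ^^ k) x) \<subseteq> (\<lambda>k. (T ^^ k) x) ` {..<N}"
    proof
      fix z assume "z \<in> range (\<lambda>k. (T ^^ k) x)"
      then obtain k where "z = (T ^^ (k mod N)) x" using funpow_mod_eq[OF N(2)] by auto
      then show "z \<in> (\<lambda>k. (T ^^ k) x) ` {..<N}" using N(1) by auto
    qed
    then show ?thesis using finite_surj by blast
  qed
  have bdd: "bdd_above (range (\<lambda>k. norm ((T ^^ k) x)))" if "x \<in> Per T" for x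
    using finite_imageI[OF fin[OF that], of norm] by (intro bdd_above_finite) (simp add: image_image)
  have h_ge: "norm x \<le> h x" if "x \<in> Per T" for x
    unfolding h_def using cSUP_upper[OF _ bdd[OF that], of 0] by simp
  have h_T: "h (T x) = h x" if x: "x \<in> Per T" for x
  proof -
    obtain N where N: "N \<ge> 1" "(T ^^ N) x = x" using x by (auto simp: Per_def)
    \<comment> \<open>A periodic orbit is the same set when started at \<open>T x\<close>: going
      once round the period returns to \<open>x\<close>.\<close>
    have "range (\<lambda>k. (T ^^ k) (T x)) = range (\<lambda>k. (T ^^ k) x)"
    proof (intro equalityI subsetI)
      fix z assume "z \<in> range (\<lambda>k. (T ^^ k) (T x))"
      then obtain k where "z = (T ^^ k) (T x)" by auto
      then have "z = (T ^^ Suc k) x" by (simp add: funpow_swap1)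
      then show "z \<in> range (\<lambda>k. (T ^^ k) x)" by blast
    next
      fix z assume "z \<in> range (\<lambda>k. (T ^^ k) x)"
      then obtain k where "z = (T ^^ k) ((T ^^ N) x)" using N by auto
      then have "z = (T ^^ (k + (N - 1))) (T x)"
        using N(1) by (cases N) (auto simp: funpow_add funpow_swap1)
      then show "z \<in> range (\<lambda>k. (T ^^ k) (T x))" by blast
    qed
    then have "norm ` range (\<lambda>k. (T ^^ k) (T x)) = norm ` range (\<lambda>k. (T ^^ k) x)" by simp
    then show ?thesis unfolding h_def by (simp add: image_image)
  qed
  have h_meas[measurable]: "h \<in> borel_measurable ?m"
    unfolding h_def
  proof (rule borel_measurable_cSUP)
    fix k
    have "(\<lambda>x. norm ((T ^^ k) x)) \<in> borel_measurable borel"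
      by (rule borel_measurable_continuous_onI) (intro continuous_on_norm continuous_T_funpow[OF T])
    then show "(\<lambda>x. norm ((T ^^ k) x)) \<in> borel_measurable ?m"
      by (intro measurable_restrict_space1) (simp add: measurable_cong_sets[OF sets_m refl])
  qed (use bdd space_m' in auto)

  let ?S = "?m \<Otimes>\<^sub>M ?U"
  interpret S: pair_prob_space ?m ?U ..
  have id_m[measurable]: "(\<lambda>x. x) \<in> measurable ?m borel"
    by (intro measurable_restrict_space1) (simp add: measurable_cong_sets[OF sets_m refl])
  have id_U[measurable]: "(\<lambda>t. t) \<in> borel_measurable ?U"
    by (intro measurable_restrict_space1) simp
  \<comment> \<open>Dividing by the invariant \<open>h\<close> bounds the samples and keeps
    equivariance; \<open>t\<close> supplies randomness along the line through \<open>x\<close>. For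
    \<open>x = 0\<close> both \<open>h x\<close> and the value are 0.\<close>
  define g where "g = (\<lambda>(x, t). (t / h x) *\<^sub>R x)"
  have g_meas[measurable]: "g \<in> measurable ?S borel"
  proof -
    have "(\<lambda>p. (snd p / h (fst p)) *\<^sub>R fst p) \<in> measurable ?S borel"
    proof (rule measurable_scaleR_real)
      show "fst \<in> measurable ?S borel" using measurable_compose[OF measurable_fst id_m] by simp
      have "snd \<in> measurable ?S borel" using measurable_compose[OF measurable_snd id_U] by simp
      moreover have "(\<lambda>p. h (fst p)) \<in> borel_measurable ?S" by measurable
      ultimately show "(\<lambda>p. snd p / h (fst p)) \<in> borel_measurable ?S" by (rule borel_measurable_divide)
    qed
    then show ?thesis by (simp add: g_def split_beta')
  qed
  define \<Theta> where "\<Theta> = (\<lambda>(x, t :: real). (T x, t))"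
  have \<Theta>_meas: "\<Theta> \<in> measurable ?S ?S" unfolding \<Theta>_def by measurable
  have \<Theta>_inv: "distr ?S ?S \<Theta> = ?S"
    unfolding \<Theta>_def
    using distr_pair_invariant[OF m'.prob_space_axioms U.prob_space_axioms T_m' measurable_ident_sets[OF refl] inv_m' distr_id2[OF refl]]
    by simp
  have g_le: "norm (g s) \<le> 1" if sS: "s \<in> space ?S" for s
  proof -
    obtain x t where s: "s = (x, t)" "x \<in> Per T" "0 \<le> t" "t \<le> 1"
      using sS by (auto simp: space_pair_measure space_m' space_restrict_space)
    have "t * norm x \<le> 1 * h x" using s h_ge[of x] by (intro mult_mono) auto
    moreover have "h x \<ge> 0" using h_ge[OF s(2)] norm_ge_zero order_trans by blast
    ultimately show ?thesis using s by (cases "h x = 0") (auto simp: g_def divide_le_eq)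
  qed
  have g_\<Theta>: "g (\<Theta> s) = T (g s)" if "s \<in> space ?S" for s
    using that by (auto simp: space_pair_measure space_m' g_def \<Theta>_def h_T linear_cmul[OF linT])
  from ex_self_similar_invariant[OF T S.prob_space_axioms g_meas g_le \<Theta>_meas \<Theta>_inv g_\<Theta>]
  obtain n where n: "invariant_prob T n" and n_eq: "distr (?S \<Otimes>\<^sub>M n) borel (\<lambda>(s, z). g s + (1/2) *\<^sub>R z) = n"
    by blast
  interpret n: prob_space n using n by (simp add: invariant_prob_def)
  have sets_n[measurable_cong]: "sets n = sets borel" using n by (simp add: invariant_prob_def)
  have space_n: "space n = UNIV" using sets_eq_imp_space_eq[OF sets_n] by simp
  interpret Sn: pair_prob_space ?S n ..

  have null: "emeasure n {x. (T ^^ N) x = x} = 0" if N: "N \<ge> 1" for N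
  proof -
    define W where "W = {x. (T ^^ N) x = x}"
    have subW: "subspace W" unfolding W_def by (rule subspace_funpow_fixed[OF linT])
    have W[measurable]: "W \<in> sets borel" unfolding W_def by (rule funpow_fixed_sets[OF T])
    have W_Per: "W \<subseteq> Per T" using N by (auto simp: W_def Per_def)
    have W_m': "W \<in> sets ?m" using W W_Per P by (simp add: sets_restrict_space_iff space_m sets_m)
    let ?\<phi> = "\<lambda>(s, z). g s + (1/2) *\<^sub>R z"
    have \<phi>[measurable]: "?\<phi> \<in> measurable (?S \<Otimes>\<^sub>M n) borel" by measurable
    let ?R = "(W \<times> {0..1}) \<times> W"
    have R: "?R \<in> sets (?S \<Otimes>\<^sub>M n)"
      using W_m' W by (auto intro!: pair_measureI simp: sets_n sets_restrict_space_iff)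
    have "AE p in ?S \<Otimes>\<^sub>M n. ?\<phi> p \<in> W \<longrightarrow> p \<in> ?R"
    proof (rule Sn.AE_pair_measure)
      have "{p \<in> space (?S \<Otimes>\<^sub>M n). ?\<phi> p \<in> W \<longrightarrow> p \<in> ?R}
          = (space (?S \<Otimes>\<^sub>M n) - (?\<phi> -` W \<inter> space (?S \<Otimes>\<^sub>M n))) \<union> ?R"
        using sets.sets_into_space[OF R] by auto
      also have "\<dots> \<in> sets (?S \<Otimes>\<^sub>M n)"
        by (intro sets.Un sets.Diff sets.top R measurable_sets[OF \<phi> W])
      finally show meas: "{p \<in> space (?S \<Otimes>\<^sub>M n). ?\<phi> p \<in> W \<longrightarrow> p \<in> ?R} \<in> sets (?S \<Otimes>\<^sub>M n)" .
      \<comment> \<open>The estimate is made for fixed \<open>z\<close> and \<open>x\<close> with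
        \<open>t\<close> random; the order of the almost-everywhere quantifiers is exchanged
        afterwards.\<close>
      have fibre: "AE s in ?S. ?\<phi> (s, z) \<in> W \<longrightarrow> (s, z) \<in> ?R" for z
      proof (rule S.AE_pair_measure)
        have "(\<lambda>s. (s, z)) \<in> measurable ?S (?S \<Otimes>\<^sub>M n)" by (rule measurable_Pair2') (simp add: space_n)
        from measurable_sets[OF this meas]
        show "{s \<in> space ?S. ?\<phi> (s, z) \<in> W \<longrightarrow> (s, z) \<in> ?R} \<in> sets ?S"
          by (rule back_subst[where P = "\<lambda>A. A \<in> sets ?S"]) (auto simp: space_pair_measure space_n)
        \<comment> \<open>If \<open>x \<in> W\<close>, a sum in \<open>W\<close> forces
          \<open>z \<in> W\<close>, so no \<open>t\<close> is exceptional; otherwise the line with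
          direction \<open>x / h x\<close> meets \<open>W\<close> for at most one
          \<open>t\<close>.\<close>
        have generic: "AE t in ?U. \<not> (?\<phi> ((x, t), z) \<in> W \<and> \<not> (x \<in> W \<and> z \<in> W))" if x: "x \<in> Per T" for x
        proof (rule AE_unit_interval_unique)
          fix s t :: real
          assume s: "?\<phi> ((x, s), z) \<in> W \<and> \<not> (x \<in> W \<and> z \<in> W)" and t: "?\<phi> ((x, t), z) \<in> W \<and> \<not> (x \<in> W \<and> z \<in> W)"
          show "s = t"
          proof (cases "x \<in> W")
            case True
            have "(g (x, s) + (1/2) *\<^sub>R z) - g (x, s) \<in> W"
              using s True by (intro subspace_diff[OF subW]) (auto simp: g_def subspace_scale[OF subW])
            then have "(1/2) *\<^sub>R z \<in> W" by simp
            then have "2 *\<^sub>R ((1/2) *\<^sub>R z) \<in> W" by (rule subspace_scale[OF subW])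
            then show ?thesis using s True by simp
          next
            case False
            then have "x \<noteq> 0" using subspace_0[OF subW] by auto
            then have hx: "h x \<noteq> 0" using h_ge[OF x] by auto
            have "(1 / h x) *\<^sub>R x \<notin> W"
            proof
              assume "(1 / h x) *\<^sub>R x \<in> W"
              then have "h x *\<^sub>R ((1 / h x) *\<^sub>R x) \<in> W" by (rule subspace_scale[OF subW])
              then show False using False hx by simp
            qed
            from subspace_line_unique[OF subW this, of "(1/2) *\<^sub>R z" s t] show ?thesis
              using s t by (simp add: g_def add.commute)
          qed
        qed
        have "AE t in ?U. ?\<phi> ((x, t), z) \<in> W \<longrightarrow> ((x, t), z) \<in> ?R" if "x \<in> space ?m" for x
        proof -
          have "x \<in> Per T" using that space_m' by simp
          from generic[OF this] AE_space[of ?U] show ?thesis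
            by eventually_elim (auto simp: space_restrict_space)
        qed
        then show "AE x in ?m. AE t in ?U. ?\<phi> ((x, t), z) \<in> W \<longrightarrow> ((x, t), z) \<in> ?R" by (rule AE_I2)
      qed
      show "AE s in ?S. AE z in n. ?\<phi> (s, z) \<in> W \<longrightarrow> (s, z) \<in> ?R"
        by (subst Sn.AE_commute) (use fibre meas in \<open>auto simp: split_beta'\<close>)
    qed
    then have "emeasure (?S \<Otimes>\<^sub>M n) (?\<phi> -` W \<inter> space (?S \<Otimes>\<^sub>M n)) \<le> emeasure (?S \<Otimes>\<^sub>M n) ?R"
      by (intro emeasure_mono_AE R) (auto elim!: eventually_mono)
    moreover have "emeasure (?S \<Otimes>\<^sub>M n) (?\<phi> -` W \<inter> space (?S \<Otimes>\<^sub>M n)) = emeasure n W"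
      using emeasure_distr[OF \<phi> W] by (simp add: n_eq)
    moreover have "emeasure (?S \<Otimes>\<^sub>M n) ?R = emeasure m W * emeasure n W"
    proof -
      have I: "{0..1} \<in> sets ?U" by (simp add: sets_restrict_space_iff)
      have "emeasure (?S \<Otimes>\<^sub>M n) ?R = emeasure ?S (W \<times> {0..1}) * emeasure n W"
        by (rule n.emeasure_pair_measure_Times) (use W_m' I W sets_n in auto)
      also have "emeasure ?S (W \<times> {0..1}) = emeasure ?m W * emeasure ?U {0..1}"
        by (rule U.emeasure_pair_measure_Times[OF W_m' I])
      finally show ?thesis using W_Per by (simp add: emeasure_restrict_space space_m P)
    qed
    ultimately have le: "measure n W \<le> measure m W * measure n W"
      by (simp add: n.emeasure_eq_measure m.emeasure_eq_measure flip: ennreal_mult)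
    have "measure m W < 1" using lt[OF N] by (simp add: W_def m.emeasure_eq_measure)
    then have "measure n W = 0"
      using le mult_strict_right_mono[of "measure m W" 1 "measure n W"] measure_nonneg[of n W] by (cases "measure n W = 0") auto
    then show ?thesis by (simp add: W_def n.emeasure_eq_measure)
  qed
  have "Per T \<in> null_sets n"
    unfolding Per_eq_Union
    by (intro null_sets_UN') (use null funpow_fixed_sets[OF T] sets_n in \<open>auto simp: null_sets_def\<close>)
  then show ?thesis using n by (auto simp: null_sets_def)
qed

text \<open>The measure is the law of \<open>x + t z\<close> with \<open>x, z, t\<close> independent, distributed according to \<open>m\<close>, \<open>n\<close> and the
  uniform law: for \<open>z\<close> off the subspace \<open>Per T\<close>, at most one \<open>t\<close> puts \<open>x + t z\<close> in \<open>Per T\<close>, or at a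
  given point.\<close>

lemma ex_invariant_full_support_null_Per:
  fixes T :: "'a \<Rightarrow> 'a"
  assumes T: "bounded_linear T" and m: "invariant_prob T m" and supp: "\<And>U. open U \<Longrightarrow> U \<noteq> {} \<Longrightarrow> emeasure m U > 0"
    and n: "invariant_prob T n" and null: "emeasure n (Per T) = 0"
  shows "\<exists>l. invariant_prob T l \<and> (\<forall>U. open U \<and> U \<noteq> {} \<longrightarrow> emeasure l U > 0)
           \<and> (\<forall>a. emeasure l {a} = 0) \<and> emeasure l (Per T) = 0"
proof -
  interpret m: prob_space m using m by (simp add: invariant_prob_def)
  interpret n: prob_space n using n by (simp add: invariant_prob_def)
  let ?U = unit_interval_measure
  interpret U: prob_space ?U by (rule prob_space_unit_interval)
  have sets_m[measurable_cong]: "sets m = sets borel" using m by (simp add: invariant_prob_def)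
  have sets_n[measurable_cong]: "sets n = sets borel" using n by (simp add: invariant_prob_def)
  have space_m: "space m = UNIV" using sets_eq_imp_space_eq[OF sets_m] by simp
  have space_n: "space n = UNIV" using sets_eq_imp_space_eq[OF sets_n] by simp
  have T_borel[measurable]: "T \<in> measurable borel borel" by (rule borel_measurable_bounded_linear_self[OF T])
  have Tm: "T \<in> measurable m m" and Tn: "T \<in> measurable n n" by measurable
  have linT: "linear T" by (rule bounded_linear.linear[OF T])
  interpret nU: pair_prob_space n ?U ..
  interpret mnU: pair_prob_space m "n \<Otimes>\<^sub>M ?U" ..
  let ?Q = "m \<Otimes>\<^sub>M (n \<Otimes>\<^sub>M ?U)"
  have id_U[measurable]: "(\<lambda>t. t) \<in> borel_measurable ?U" by (intro measurable_restrict_space1) simp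
  define \<phi> where "\<phi> = (\<lambda>(x :: 'a, z, t :: real). x + t *\<^sub>R z)"
  have \<phi>[measurable]: "\<phi> \<in> measurable ?Q borel"
  proof -
    have "(\<lambda>p. snd (snd p)) \<in> borel_measurable ?Q"
      using measurable_compose[OF measurable_compose[OF measurable_snd measurable_snd] id_U] by simp
    then have "(\<lambda>p. fst p + snd (snd p) *\<^sub>R fst (snd p)) \<in> measurable ?Q borel" by measurable
    then show ?thesis by (simp add: \<phi>_def split_beta')
  qed
  define l where "l = distr ?Q borel \<phi>"
  have l: "emeasure l A = emeasure ?Q (\<phi> -` A \<inter> space ?Q)" if "A \<in> sets borel" for A
    using that by (simp add: l_def emeasure_distr)
  have "prob_space l" unfolding l_def by (rule mnU.prob_space_distr[OF \<phi>])
  moreover have "distr l borel T = l"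
  proof -
    define \<Psi> where "\<Psi> = (\<lambda>(x, p). (T x, (\<lambda>(z, t :: real). (T z, t)) p))"
    have inv_nU: "distr (n \<Otimes>\<^sub>M ?U) (n \<Otimes>\<^sub>M ?U) (\<lambda>(z, t). (T z, t)) = n \<Otimes>\<^sub>M ?U"
      by (rule distr_pair_invariant[OF n.prob_space_axioms U.prob_space_axioms Tn measurable_ident_sets[OF refl]
            invariant_prob_distr_self[OF n] distr_id2[OF refl]])
    have m_nU: "(\<lambda>(z, t). (T z, t)) \<in> measurable (n \<Otimes>\<^sub>M ?U) (n \<Otimes>\<^sub>M ?U)" using Tn by measurable
    have inv_\<Psi>: "distr ?Q ?Q \<Psi> = ?Q"
      unfolding \<Psi>_def
      by (rule distr_pair_invariant[OF m.prob_space_axioms nU.prob_space_axioms Tm m_nU invariant_prob_distr_self[OF m] inv_nU])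
    have \<Psi>: "\<Psi> \<in> measurable ?Q ?Q" unfolding \<Psi>_def using Tm m_nU by measurable
    have "distr l borel T = distr ?Q borel (T \<circ> \<phi>)" unfolding l_def by (rule distr_distr[OF T_borel \<phi>])
    also have "T \<circ> \<phi> = \<phi> \<circ> \<Psi>"
      by (auto simp: fun_eq_iff \<phi>_def \<Psi>_def linear_add[OF linT] linear_cmul[OF linT])
    also have "distr ?Q borel (\<phi> \<circ> \<Psi>) = distr (distr ?Q ?Q \<Psi>) borel \<phi>" by (rule distr_distr[OF \<phi> \<Psi>, symmetric])
    also have "\<dots> = l" by (simp add: inv_\<Psi> l_def)
    finally show ?thesis .
  qed
  \<comment> \<open>One argument serves \<open>Per T\<close> and single points: each meets a line
    with non-periodic direction at most once.\<close>
  moreover have null_l: "emeasure l S = 0"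
    if S[measurable]: "S \<in> sets borel" and uniq: "\<And>x z s t. z \<notin> Per T \<Longrightarrow> x + s *\<^sub>R z \<in> S \<Longrightarrow> x + t *\<^sub>R z \<in> S \<Longrightarrow> s = t" for S
  proof -
    have AE_n: "AE z in n. z \<notin> Per T"
      using null Per_sets[OF T] by (intro AE_not_in) (simp add: null_sets_def sets_n)
    have meas: "{p \<in> space ?Q. \<phi> p \<notin> S} \<in> sets ?Q" by measurable
    have "AE p in ?Q. \<phi> p \<notin> S"
    proof (rule mnU.AE_pair_measure[OF meas], rule AE_I2, rule nU.AE_pair_measure)
      fix x assume x: "x \<in> space m"
      have "Pair x \<in> measurable (n \<Otimes>\<^sub>M ?U) ?Q" by (rule measurable_Pair1'[OF x])
      from measurable_sets[OF this meas]
      show "{p \<in> space (n \<Otimes>\<^sub>M ?U). \<phi> (x, p) \<notin> S} \<in> sets (n \<Otimes>\<^sub>M ?U)"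
        by (rule back_subst[where P = "\<lambda>A. A \<in> sets (n \<Otimes>\<^sub>M ?U)"]) (auto simp: space_pair_measure space_m)
      show "AE z in n. AE t in ?U. \<phi> (x, z, t) \<notin> S"
        using AE_n
      proof eventually_elim
        case (elim z)
        show ?case by (rule AE_unit_interval_unique) (use uniq[OF elim, of x] in \<open>auto simp: \<phi>_def\<close>)
      qed
    qed
    then have "emeasure ?Q {p \<in> space ?Q. \<not> \<phi> p \<notin> S} = 0"
      using AE_iff_measurable[of "{p \<in> space ?Q. \<not> \<phi> p \<notin> S}" ?Q "\<lambda>p. \<phi> p \<notin> S"] by simp
    also have "{p \<in> space ?Q. \<not> \<phi> p \<notin> S} = \<phi> -` S \<inter> space ?Q" by auto
    finally show ?thesis using l[OF S] by simp
  qed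
  moreover have "emeasure l (Per T) = 0"
    by (rule null_l[OF Per_sets[OF T]]) (use subspace_line_unique[OF subspace_Per[OF linT]] in blast)
  moreover have "emeasure l {a} = 0" for a
  proof (rule null_l)
    fix x z :: 'a and s t :: real assume "z \<notin> Per T" "x + s *\<^sub>R z \<in> {a}" "x + t *\<^sub>R z \<in> {a}"
    moreover have "0 \<in> Per T" by (rule subspace_0[OF subspace_Per[OF linT]])
    ultimately show "s = t" by (metis add_left_cancel scaleR_cancel_right singletonD)
  qed simp
  moreover have "emeasure l V > 0" if V: "open V" "V \<noteq> {}" for V
  proof -
    obtain a e where e: "e > 0" "ball a e \<subseteq> V" using V by (meson equals0I openE)
    have "\<exists>R::nat. emeasure n (cball 0 R) > 0"
    proof (rule ccontr)
      assume "\<not> ?thesis"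
      then have "(\<Union>R::nat. cball 0 (real R)) \<in> null_sets n"
        by (intro null_sets_UN) (auto simp: null_sets_def sets_n not_less)
      moreover have "(\<Union>R::nat. cball 0 (real R)) = (UNIV :: 'a set)"
        using real_arch_simple by (auto simp: set_eq_iff)
      ultimately show False using n.emeasure_space_1 by (simp add: null_sets_def space_n)
    qed
    then obtain R :: nat where R: "emeasure n (cball 0 R) > 0" by blast
    \<comment> \<open>The bound 1 keeps \<open>t\<close> inside the unit interval, and
      \<open>real R + 1\<close> avoids division by zero; for \<open>norm z \<le> R\<close> and
      \<open>t \<le> \<delta>\<close> the perturbation \<open>t *\<^sub>R z\<close> has norm at most
      \<open>e / 2\<close>.\<close>
    define \<delta> where "\<delta> = min 1 (e / (2 * (real R + 1)))"
    have \<delta>: "0 < \<delta>" "\<delta> \<le> 1" "\<delta> * real R \<le> e / 2"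
    proof -
      show "0 < \<delta>" "\<delta> \<le> 1" using e by (auto simp: \<delta>_def)
      have "\<delta> * real R \<le> e / (2 * (real R + 1)) * (real R + 1)"
        using e by (intro mult_mono) (auto simp: \<delta>_def)
      also have "\<dots> = e / 2" using of_nat_0_le_iff[of R, where 'a = real] by (simp add: divide_simps)
      finally show "\<delta> * real R \<le> e / 2" .
    qed
    let ?B = "ball a (e/2) \<times> (cball (0::'a) (real R) \<times> {0..\<delta>})"
    have I: "{0..\<delta>} \<in> sets ?U" using \<delta> by (auto simp: sets_restrict_space_iff)
    have C: "cball (0::'a) (real R) \<times> {0..\<delta>} \<in> sets (n \<Otimes>\<^sub>M ?U)" using I by (intro pair_measureI) (auto simp: sets_n)
    have "emeasure ?Q ?B = emeasure m (ball a (e/2)) * emeasure (n \<Otimes>\<^sub>M ?U) (cball (0::'a) (real R) \<times> {0..\<delta>})"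
      by (rule nU.emeasure_pair_measure_Times[OF _ C]) (simp add: sets_m)
    also have "emeasure (n \<Otimes>\<^sub>M ?U) (cball (0::'a) (real R) \<times> {0..\<delta>}) = emeasure n (cball 0 (real R)) * emeasure ?U {0..\<delta>}"
      by (rule U.emeasure_pair_measure_Times[OF _ I]) (simp add: sets_n)
    also have "emeasure ?U {0..\<delta>} = ennreal \<delta>" using \<delta> by (simp add: emeasure_restrict_space)
    finally have "emeasure ?Q ?B > 0"
      using supp[of "ball a (e/2)"] e R \<delta> by (simp add: ennreal_zero_less_mult_iff)
    also have "emeasure ?Q ?B \<le> emeasure ?Q (\<phi> -` V \<inter> space ?Q)"
    proof (rule emeasure_mono)
      show "?B \<subseteq> \<phi> -` V \<inter> space ?Q"
      proof
        fix p assume "p \<in> ?B"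
        then obtain x z t where p: "p = (x, z, t)" "dist a x < e/2" "norm z \<le> real R" "0 \<le> t" "t \<le> \<delta>" by auto
        have "norm (t *\<^sub>R z) \<le> \<delta> * real R" using p by (simp add: mult_mono)
        then have "dist a (x + t *\<^sub>R z) < e"
          using p(2) \<delta>(3) norm_triangle_ineq4[of "a - x" "t *\<^sub>R z"] by (simp add: dist_norm diff_diff_eq)
        then have "x + t *\<^sub>R z \<in> V" using e(2) by auto
        then show "p \<in> \<phi> -` V \<inter> space ?Q"
          using p \<delta> by (auto simp: \<phi>_def space_pair_measure space_m space_n space_restrict_space)
      qed
      show "\<phi> -` V \<inter> space ?Q \<in> sets ?Q" using V(1) by (intro measurable_sets[OF \<phi>]) simp
    qed
    also have "\<dots> = emeasure l V" using V(1) by (simp add: l)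
    finally show ?thesis .
  qed
  ultimately show ?thesis unfolding invariant_prob_def by (intro exI[of _ l]) (auto simp: l_def)
qed

end

theorem theorem1p1:
  fixes T :: "'a::banach \<Rightarrow> 'a"
  assumes "separable_space TYPE('a)"
    and "infinite_dimensional TYPE('a)"
    and "reflexive_space TYPE('a)"
    and "bounded_linear T"
    and "frequently_hypercyclic T"
  shows "\<exists>m :: 'a measure. prob_space m \<and> sets m = sets borel
           \<and> (\<forall>A\<in>sets borel. emeasure m (T -` A) = emeasure m A)
           \<and> (\<forall>U. open U \<and> U \<noteq> {} \<longrightarrow> emeasure m U > 0)
           \<and> (\<forall>a. emeasure m {a} = 0)
           \<and> emeasure m (Per T) = 0"
proof -
  obtain f :: "nat \<Rightarrow> 'a \<Rightarrow>\<^sub>L real" and d where fd: "separable_reflexive f d"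
    using ex_separable_reflexive[OF assms(1,3)] by blast
  interpret separable_reflexive f d by (rule fd)
  obtain x0 where x0: "\<And>V. open V \<Longrightarrow> V \<noteq> {} \<Longrightarrow>
      liminf (\<lambda>N. ereal (real (card {n\<in>{1..N}. (T ^^ n) x0 \<in> V}) / real N)) > 0"
    using assms(5) unfolding frequently_hypercyclic_def by blast
  have freq_pos: "\<exists>e>0. \<forall>\<^sub>F N in sequentially. e \<le> freq (\<lambda>n. (T ^^ n) x0) N V" if V: "open V" "V \<noteq> {}" for V
  proof -
    obtain e where e: "0 < ereal e" "ereal e < liminf (\<lambda>N. ereal (freq (\<lambda>n. (T ^^ n) x0) N V))"
      using ereal_dense2[OF x0[OF V]] unfolding freq_def by blast
    then show ?thesis using less_LiminfD[OF e(2)] by (intro exI[of _ e]) (auto elim: eventually_mono)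
  qed
  interpret frequently_hypercyclic_operator f d T x0
    by (intro frequently_hypercyclic_operator.intro frequently_hypercyclic_operator_axioms.intro fd assms(4) freq_pos)
  obtain m where m: "invariant_prob T m" and supp: "\<And>U. open U \<Longrightarrow> U \<noteq> {} \<Longrightarrow> emeasure m U > 0"
    using ex_invariant_full_support by blast
  interpret m: prob_space m using m by (simp add: invariant_prob_def)
  have sets_m: "sets m = sets borel" using m by (simp add: invariant_prob_def)
  \<comment> \<open>If \<open>T ^^ N\<close> were the identity, the orbit of \<open>x0\<close> would
    be finite, hence closed, with a complement that is open and never visited. That complement would
    be empty and the space finite, contrary to infinite dimension. So the fixed set is a proper
    closed subspace, and full support charges its complement.\<close>
  have lt: "emeasure m {x. (T ^^ N) x = x} < 1" if N: "N \<ge> 1" for N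
  proof -
    let ?W = "{x. (T ^^ N) x = x}"
    have "?W \<noteq> UNIV"
    proof
      assume "?W = UNIV"
      then have "x0 \<in> ?W" by (simp only: UNIV_I)
      then have *: "(T ^^ N) x0 = x0" by simp
      have "range (\<lambda>n. (T ^^ n) x0) \<subseteq> (\<lambda>n. (T ^^ n) x0) ` {..<N}"
      proof
        fix z assume "z \<in> range (\<lambda>n. (T ^^ n) x0)"
        then obtain k where "z = (T ^^ (k mod N)) x0" using funpow_mod_eq[OF *] by auto
        then show "z \<in> (\<lambda>n. (T ^^ n) x0) ` {..<N}" using N by auto
      qed
      then have fin: "finite (range (\<lambda>n. (T ^^ n) x0))" using finite_surj by blast
      have "- range (\<lambda>n. (T ^^ n) x0) = {}"
      proof (rule ccontr)
        assume ne: "- range (\<lambda>n. (T ^^ n) x0) \<noteq> {}"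
        have "open (- range (\<lambda>n. (T ^^ n) x0))" by (rule open_Compl[OF finite_imp_closed[OF fin]])
        from x0[OF this ne] show False by (simp add: Liminf_const)
      qed
      then have "finite (UNIV :: 'a set)" using fin by (metis Compl_empty_eq double_complement)
      then show False
        using assms(2) span_UNIV unfolding infinite_dimensional_def by blast
    qed
    then have "- ?W \<noteq> {}" by auto
    moreover have "open (- ?W)" using closed_funpow_fixed[OF assms(4), of N] by (simp add: open_Compl)
    ultimately have "emeasure m (- ?W) > 0" using supp by blast
    moreover have "- ?W = space m - ?W" using sets_eq_imp_space_eq[OF sets_m] by auto
    ultimately have "measure m (space m - ?W) > 0" by (simp add: m.emeasure_eq_measure)
    then have "measure m ?W < 1"
      using m.prob_compl[of ?W] funpow_fixed_sets[OF assms(4), of N] sets_m by simp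
    then show ?thesis by (simp add: m.emeasure_eq_measure)
  qed
  have "\<exists>n. invariant_prob T n \<and> emeasure n (Per T) = 0"
    using invariant_prob_off_Per[OF assms(4) m] ex_invariant_null_Per_if_Per_full[OF assms(4) m _ lt] by blast
  then obtain l where l: "invariant_prob T l" "\<forall>U. open U \<and> U \<noteq> {} \<longrightarrow> emeasure l U > 0"
    "\<forall>a. emeasure l {a} = 0" "emeasure l (Per T) = 0"
    using ex_invariant_full_support_null_Per[OF assms(4) m supp] by blast
  have sets_l: "sets l = sets borel" using l by (simp add: invariant_prob_def)
  have "emeasure l (T -` A) = emeasure l A" if A: "A \<in> sets borel" for A
  proof -
    have "T \<in> measurable l borel" using T_measurable by (simp add: measurable_cong_sets[OF sets_l refl])
    from emeasure_distr[OF this A] show ?thesis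
      using l(1) sets_eq_imp_space_eq[OF sets_l] by (simp add: invariant_prob_def)
  qed
  then show ?thesis using l unfolding invariant_prob_def by blast
qed

end
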